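(* Let $K\subseteq G_5$ be a congruence subgroup of geometric level $m$ and algebraic level $(\pi)$. Let $n$ be the rational integer below $(\pi)$. Then the following holds. (i) Suppose that $m\not\equiv 0 \pmod 4$. Then $G(m)\subseteq K$ and $n=m$. (ii) Suppose that $4\mid m$. Then $G(2m)\subseteq K$ and $n$ is either $m$ or $2m$.
   Context: Let $\lambda=2\cos(\pi/5)$ (so $\lambda^2=\lambda+1$), where in this formula $\pi$ is the usual real number; elsewhere $\pi$ denotes an element of $\mathbb{Z}[\lambda]$. The homogeneous Hecke group $H_5$ is the subgroup of $SL(2,\mathbb{Z}[\lambda])$ generated by $T=\begin{pmatrix}1&\lambda\\0&1\end{pmatrix}$ and $S=\begin{pmatrix}0&1\\-1&0\end{pmatrix}$. Put $Z=\langle\pm I\rangle$. For $\tau\in\mathbb{Z}[\lambda]$ let $H(\tau)=\{A\in H_5 : A\equiv I \pmod{\tau}\}$ (entrywise congruence in $\mathbb{Z}[\lambda]$). The inhomogeneous Hecke group is $G_5=H_5/Z$, and its principal congruence subgroups are $G(\tau)=H(\tau)Z/Z$; thus in $G_5$ a matrix is identified with its negative, and $S,T$ also denote their images in $G_5$. A subgroup $K$ of $G_5$ is a congruence subgroup if $G(\tau)\subseteq K$ for some nonzero $\tau\in\mathbb{Z}[\lambda]$ (such $K$ has finite index). The algebraic level of a congruence subgroup $K$ is the ideal $(\pi)$ of $\mathbb{Z}[\lambda]$ with $\pi \neq 0$, $G(\pi)\subseteq K$, and such that $G(\tau)\subseteq G(\pi)$ whenever $G(\tau)\subseteq K$. The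 rational integer below $(\pi)$ is the smallest positive rational integer contained in $(\pi)$. The cusps are the points of the $G_5$-orbit of $\infty$ under Möbius transformations. The width (with respect to $K$) of a cusp $x$ is the smallest positive integer $w$ such that $\pm T^w$ is conjugate in $G_5$ to an element of $K$ fixing $x$. The geometric level of $K$ is the least common multiple of the widths (with respect to $K$) of all cusps. *)

theory Defs
  imports "HOL-Analysis.Determinants" "HOL-Algebra.Generated_Groups" "HOL-Algebra.Ideal"
begin

definition lam :: real where
  "lam = 2 * cos (pi / 5)"

definition Zlam :: "real ring" where
  "Zlam = \<lparr>carrier = {of_int a + of_int b * lam | a b. True},
           mult = (*), one = 1, zero = 0, add = (+)\<rparr>"

definition SL2Zlam :: "(real^2^2) monoid" where
  "SL2Zlam = \<lparr>carrier = {A. (\<forall>i j. A $ i $ j \<in> carrier Zlam) \<and> det A = 1},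
              mult = (**), one = mat 1\<rparr>"

definition matT :: "real^2^2" where
  "matT = vector [vector [1, lam], vector [0, 1]]"

definition matS :: "real^2^2" where
  "matS = vector [vector [0, 1], vector [-1, 0]]"

definition H5 :: "(real^2^2) monoid" where
  "H5 = SL2Zlam\<lparr>carrier := generate SL2Zlam {matS, matT}\<rparr>"

definition ZI :: "(real^2^2) set" where
  "ZI = {mat 1, - mat 1}"

text \<open>The elements of \<open>G5\<close> are the cosets \<open>{A, - A}\<close> with \<open>A\<close> in \<open>H5\<close>.\<close>

definition G5 :: "(real^2^2) set monoid" where
  "G5 = H5 Mod ZI"

definition H_pr :: "real \<Rightarrow> (real^2^2) set" where
  "H_pr \<tau> = {A \<in> carrier H5. \<forall>i j. A $ i $ j - mat 1 $ i $ j \<in> PIdl\<^bsub>Zlam\<^esub> \<tau>}"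

definition G_pr :: "real \<Rightarrow> (real^2^2) set set" where
  "G_pr \<tau> = (\<lambda>A. ZI #>\<^bsub>H5\<^esub> A) ` (H_pr \<tau> <#>\<^bsub>H5\<^esub> ZI)"

definition congruence_subgroup :: "(real^2^2) set set \<Rightarrow> bool" where
  "congruence_subgroup K \<longleftrightarrow>
     subgroup K G5 \<and> (\<exists>\<tau> \<in> carrier Zlam. \<tau> \<noteq> 0 \<and> G_pr \<tau> \<subseteq> K)"

text \<open>The level is an ideal; the condition on it is independent of the choice of generator,
  since \<open>G_pr \<pi>\<close> depends only on the ideal generated by \<open>\<pi>\<close>.\<close>

definition is_algebraic_level :: "(real^2^2) set set \<Rightarrow> real set \<Rightarrow> bool" where
  "is_algebraic_level K I \<longleftrightarrow>
     (\<exists>\<pi> \<in> carrier Zlam. \<pi> \<noteq> 0 \<and> I = PIdl\<^bsub>Zlam\<^esub> \<pi> \<and> G_pr \<pi> \<subseteq> K \<and>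
        (\<forall>\<tau> \<in> carrier Zlam. G_pr \<tau> \<subseteq> K \<longrightarrow> G_pr \<tau> \<subseteq> G_pr \<pi>))"

definition integer_below :: "real set \<Rightarrow> nat" where
  "integer_below I = (LEAST n. 0 < n \<and> real n \<in> I)"

text \<open>The boundary of the upper half plane is \<open>real option\<close>, with \<open>None\<close> as the point at infinity.\<close>

fun moebius :: "real^2^2 \<Rightarrow> real option \<Rightarrow> real option" where
  "moebius A None = (if A $ 2 $ 1 = 0 then None else Some (A $ 1 $ 1 / A $ 2 $ 1))"
| "moebius A (Some x) =
     (if A $ 2 $ 1 * x + A $ 2 $ 2 = 0 then None
      else Some ((A $ 1 $ 1 * x + A $ 1 $ 2) / (A $ 2 $ 1 * x + A $ 2 $ 2)))"

text \<open>Both representatives of an element of \<open>G5\<close> act in the same way, so the image below is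
  a singleton.\<close>

definition G5_act :: "(real^2^2) set \<Rightarrow> real option \<Rightarrow> real option" where
  "G5_act g x = the_elem ((\<lambda>A. moebius A x) ` g)"

definition cusps :: "real option set" where
  "cusps = {G5_act g None | g. g \<in> carrier G5}"

definition T5 :: "(real^2^2) set" where
  "T5 = ZI #>\<^bsub>H5\<^esub> matT"

definition cusp_width :: "(real^2^2) set set \<Rightarrow> real option \<Rightarrow> nat" where
  "cusp_width K x =
     (LEAST w. 0 < w \<and>
        (\<exists>g \<in> carrier G5. \<exists>k \<in> K.
           k = g \<otimes>\<^bsub>G5\<^esub> (T5 [^]\<^bsub>G5\<^esub> w) \<otimes>\<^bsub>G5\<^esub> inv\<^bsub>G5\<^esub> g \<and> G5_act k x = x))"

text \<open>\<open>Lcm\<close> of an infinite set of naturals is 0; for a congruence subgroup the set of widths is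
  finite.\<close>

definition geometric_level :: "(real^2^2) set set \<Rightarrow> nat" where
  "geometric_level K = Lcm (cusp_width K ` cusps)"

end

theory Submission
  imports Defs
begin

text \<open>Write \<open>\<Delta>(m)\<close> for the normal closure of \<open>T ^ m\<close> in \<open>H5\<close>. The stabiliser of \<open>\<infinity>\<close> in \<open>G5\<close> is
  generated by \<open>T\<close>, so the geometric level of \<open>K\<close> is the least \<open>m > 0\<close> with \<open>\<Delta>(m)\<close> in the preimage
  of \<open>K\<close>. As in Wohlfahrt's theorem everything follows from \<open>H(m) \<subseteq> \<Delta>(m) H(N)\<close> for all \<open>N > 0\<close> if
  \<open>4\<close> does not divide \<open>m\<close>, and \<open>H(2 m) \<subseteq> \<Delta>(m) H(N)\<close> if it does.

  Primes dividing \<open>m\<close>: modulo \<open>m ^ 2\<close>, \<open>\<Delta>(m)\<close> consists of the matrices \<open>1 + m X\<close> with \<open>X\<close> in the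
  \<open>\<int>\<close>-span of the conjugates of \<open>\<lambda> E\<^sub>1\<^sub>2\<close>, and this span contains \<open>2 sl\<^sub>2(\<int>[\<lambda>])\<close>. Hence one can pass from
  \<open>H(m)\<close> to \<open>H(m r)\<close> for odd \<open>r\<close> dividing \<open>m\<close>, and from \<open>H(2 m)\<close> to \<open>H(2 m r)\<close> when \<open>2 r\<close> divides \<open>m\<close>.
  Primes not dividing \<open>m\<close>, and the prime 2 when \<open>m\<close> is twice an odd number: here \<open>H(d) = \<Delta>(d)\<close> for \<open>d = 1, 2\<close>,
  and in a product of conjugates of powers of \<open>T ^ d\<close> one replaces \<open>T\<close> by \<open>T ^ a\<close>, with \<open>a\<close> given by
  the Chinese remainder theorem.\<close>

section \<open>The ring \<open>\<int>[\<lambda>]\<close>\<close>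

abbreviation Zl :: "real set" where
  "Zl \<equiv> carrier Zlam"

lemma lam_pos: "lam > 0"
proof -
  have "cos (pi / 5) > 0"
    using pi_gt_zero by (intro cos_gt_zero_pi) linarith+
  then show ?thesis by (simp add: lam_def)
qed

text \<open>With \<open>c = cos (pi / 5)\<close>, the relation
  \<open>3 * (pi / 5) = pi - 2 * (pi / 5)\<close> gives a cubic equation for \<open>c\<close>;
  splitting off its root -1 leaves the claim.\<close>

lemma lam_sq: "lam * lam = lam + 1"
proof -
  define c where "c = cos (pi / 5)"
  have "cos (3 * (pi / 5)) = cos (pi - 2 * (pi / 5))"
    by (rule arg_cong[where f = cos]) simp
  also have "\<dots> = - cos (2 * (pi / 5))"
    by (simp only: cos_pi_minus)
  finally have "4 * c ^ 3 - 3 * c = - (2 * c ^ 2 - 1)"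
    by (simp only: cos_treble_cos cos_double_cos c_def)
  then have "(c + 1) * (4 * c ^ 2 - 2 * c - 1) = 0"
    by (simp add: algebra_simps power2_eq_square power3_eq_cube)
  moreover have "c + 1 \<noteq> 0"
    using lam_pos by (simp add: c_def lam_def)
  ultimately have "4 * c ^ 2 - 2 * c - 1 = 0" by simp
  then show ?thesis
    by (simp add: lam_def c_def power2_eq_square)
qed

text \<open>Infinite descent: the form is even only if both arguments are, and halving them gives a
  smaller zero. This is the norm form of Z[lambda], so nonzero elements have nonzero norm.\<close>

lemma norm_form_eq_0:
  fixes a b :: int
  assumes "a * a + a * b - b * b = 0"
  shows "a = 0 \<and> b = 0"
  using assms
proof (induction "nat (\<bar>a\<bar> + \<bar>b\<bar>)" arbitrary: a b rule: less_induct)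
  case less
  show ?case
  proof (rule ccontr)
    assume nz: "\<not> (a = 0 \<and> b = 0)"
    have "even (a * a + a * b - b * b)" using less.prems by simp
    then have "even a" "even b" by auto
    then obtain a' b' where ab: "a = 2 * a'" "b = 2 * b'" by (auto elim!: evenE)
    then have "a' * a' + a' * b' - b' * b' = 0" using less.prems by (simp add: algebra_simps)
    moreover have "nat (\<bar>a'\<bar> + \<bar>b'\<bar>) < nat (\<bar>a\<bar> + \<bar>b\<bar>)" using ab nz by auto
    ultimately have "a' = 0 \<and> b' = 0" using less.hyps by blast
    then show False using ab nz by simp
  qed
qed

text \<open>The Galois conjugate of \<open>lam\<close> is \<open>1 - lam\<close>, so the second
  factor is the conjugate of the first.\<close>

lemma Zl_norm: "(of_int a + of_int b * lam) * (of_int a + of_int b - of_int b * lam)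
    = of_int (a * a + a * b - b * b)"
proof -
  have "(x + y * l) * (x + y - y * l) = x * x + x * y - y * y" if "l * l = l + 1" for l x y :: real
    using that by Groebner_Basis.algebra
  from this[OF lam_sq] show ?thesis by simp
qed

lemma lam_independent:
  assumes "of_int a + of_int b * lam = 0"
  shows "a = 0 \<and> b = 0"
proof -
  have "real_of_int (a * a + a * b - b * b) = 0"
    using Zl_norm[of a b] assms by simp
  then show ?thesis by (intro norm_form_eq_0) (simp only: of_int_eq_0_iff)
qed

lemma Zl_iff: "x \<in> Zl \<longleftrightarrow> (\<exists>a b. x = of_int a + of_int b * lam)"
  by (simp add: Zlam_def)

lemma Zl_int [simp]: "of_int a \<in> Zl"
  unfolding Zl_iff by (rule exI[of _ a], rule exI[of _ 0]) simp

lemma Zl_nat [simp]: "of_nat a \<in> Zl"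
  using Zl_int[of "int a"] by simp

lemma Zl_numeral [simp]: "0 \<in> Zl" "1 \<in> Zl" "numeral k \<in> Zl"
  using Zl_int[of 0] Zl_int[of 1] Zl_int[of "numeral k"] by simp_all

lemma Zl_lam [simp]: "lam \<in> Zl"
  unfolding Zl_iff by (rule exI[of _ 0], rule exI[of _ 1]) simp

lemma Zl_add [simp]: "x \<in> Zl \<Longrightarrow> y \<in> Zl \<Longrightarrow> x + y \<in> Zl"
  unfolding Zl_iff
proof (elim exE)
  fix a b c d assume "x = of_int a + of_int b * lam" "y = of_int c + of_int d * lam"
  then show "\<exists>a b. x + y = of_int a + of_int b * lam"
    by (intro exI[of _ "a + c"] exI[of _ "b + d"]) (simp add: algebra_simps)
qed

lemma Zl_minus [simp]: "x \<in> Zl \<Longrightarrow> - x \<in> Zl"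
  unfolding Zl_iff
proof (elim exE)
  fix a b assume "x = of_int a + of_int b * lam"
  then show "\<exists>a b. - x = of_int a + of_int b * lam"
    by (intro exI[of _ "- a"] exI[of _ "- b"]) (simp add: algebra_simps)
qed

lemma Zl_diff [simp]: "x \<in> Zl \<Longrightarrow> y \<in> Zl \<Longrightarrow> x - y \<in> Zl"
  using Zl_add[OF _ Zl_minus] by simp

lemma Zl_mult [simp]:
  assumes "x \<in> Zl" "y \<in> Zl" shows "x * y \<in> Zl"
proof -
  have eq: "(a + b * l) * (c + d * l) = (a * c + b * d) + (a * d + b * c + b * d) * l"
    if "l * l = l + 1" for l a b c d :: real
    using that by Groebner_Basis.algebra
  obtain a b c d where "x = of_int a + of_int b * lam" "y = of_int c + of_int d * lam"
    using assms by (auto simp: Zl_iff)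
  then show ?thesis unfolding Zl_iff
    by (intro exI[of _ "a * c + b * d"] exI[of _ "a * d + b * c + b * d"]) (simp add: eq[OF lam_sq])
qed

lemma PIdl_iff: "x \<in> PIdl\<^bsub>Zlam\<^esub> r \<longleftrightarrow> (\<exists>z\<in>Zl. x = z * r)"
  by (auto simp: cgenideal_def) (auto simp: Zlam_def)

lemma PIdl_0 [simp]: "0 \<in> PIdl\<^bsub>Zlam\<^esub> r"
  unfolding PIdl_iff by (rule bexI[of _ 0]) auto

lemma PIdl_add: "x \<in> PIdl\<^bsub>Zlam\<^esub> r \<Longrightarrow> y \<in> PIdl\<^bsub>Zlam\<^esub> r \<Longrightarrow> x + y \<in> PIdl\<^bsub>Zlam\<^esub> r"
  unfolding PIdl_iff by (metis Zl_add distrib_right)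

lemma PIdl_minus: "x \<in> PIdl\<^bsub>Zlam\<^esub> r \<Longrightarrow> - x \<in> PIdl\<^bsub>Zlam\<^esub> r"
  unfolding PIdl_iff by (metis Zl_minus minus_mult_left)

lemma PIdl_diff: "x \<in> PIdl\<^bsub>Zlam\<^esub> r \<Longrightarrow> y \<in> PIdl\<^bsub>Zlam\<^esub> r \<Longrightarrow> x - y \<in> PIdl\<^bsub>Zlam\<^esub> r"
  using PIdl_add[OF _ PIdl_minus] by fastforce

lemma PIdl_mult_left: "x \<in> Zl \<Longrightarrow> y \<in> PIdl\<^bsub>Zlam\<^esub> r \<Longrightarrow> x * y \<in> PIdl\<^bsub>Zlam\<^esub> r"
  unfolding PIdl_iff by (metis Zl_mult mult.assoc)

lemma PIdl_mult_right: "x \<in> Zl \<Longrightarrow> y \<in> PIdl\<^bsub>Zlam\<^esub> r \<Longrightarrow> y * x \<in> PIdl\<^bsub>Zlam\<^esub> r"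
  using PIdl_mult_left by (simp add: mult.commute)

lemma PIdl_subset: "s \<in> PIdl\<^bsub>Zlam\<^esub> r \<Longrightarrow> PIdl\<^bsub>Zlam\<^esub> s \<subseteq> PIdl\<^bsub>Zlam\<^esub> r"
  using PIdl_mult_left by (auto simp: PIdl_iff[of _ s])

lemma PIdl_int_dvd:
  assumes "(M::int) dvd N" shows "PIdl\<^bsub>Zlam\<^esub> (of_int N) \<subseteq> PIdl\<^bsub>Zlam\<^esub> (of_int M)"
proof -
  from assms obtain k where "N = k * M" by (metis dvdE mult.commute)
  then have "of_int N \<in> PIdl\<^bsub>Zlam\<^esub> (of_int M)" unfolding PIdl_iff by (intro bexI[of _ "of_int k"]) auto
  then show ?thesis by (rule PIdl_subset)
qed

lemma PIdl_coprime:
  fixes M N :: int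
  assumes "coprime M N" "x \<in> PIdl\<^bsub>Zlam\<^esub> (of_int M)" "x \<in> PIdl\<^bsub>Zlam\<^esub> (of_int N)"
  shows "x \<in> PIdl\<^bsub>Zlam\<^esub> (of_int (M * N))"
proof -
  obtain u v where "u * M + v * N = 1"
    using assms(1) by (metis bezout_int coprime_imp_gcd_eq_1)
  then have uv: "of_int u * of_int M + of_int v * of_int N = (1::real)"
    by (metis of_int_1 of_int_add of_int_mult)
  obtain y z where y: "y \<in> Zl" "x = y * of_int M" and z: "z \<in> Zl" "x = z * of_int N"
    using assms unfolding PIdl_iff by blast
  have "x = (of_int u * of_int M + of_int v * of_int N) * x" using uv by simp
  also have "\<dots> = of_int u * of_int M * x + of_int v * of_int N * x" by (simp add: algebra_simps)
  also have "of_int u * of_int M * x = of_int u * of_int M * (z * of_int N)" using z by simp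
  also have "of_int v * of_int N * x = of_int v * of_int N * (y * of_int M)" using y by simp
  also have "of_int u * of_int M * (z * of_int N) + of_int v * of_int N * (y * of_int M)
    = (of_int u * z + of_int v * y) * of_int (M * N)" by (simp add: algebra_simps)
  finally show ?thesis unfolding PIdl_iff using y(1) z(1)
    by (intro bexI[of _ "of_int u * z + of_int v * y"]) simp_all
qed

text \<open>The norm of \<open>r\<close> is a nonzero integer and a multiple of \<open>r\<close>;
  its absolute value serves.\<close>

lemma PIdl_imp_pos_nat:
  assumes "r \<in> Zl" "r \<noteq> 0"
  shows "\<exists>n::nat. 0 < n \<and> real n \<in> PIdl\<^bsub>Zlam\<^esub> r"
proof -
  obtain a b where r: "r = of_int a + of_int b * lam" using assms by (auto simp: Zl_iff)
  define N where "N = a * a + a * b - b * b"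
  have "N \<noteq> 0" using norm_form_eq_0[of a b] assms r by (auto simp: N_def)
  have "of_int N \<in> PIdl\<^bsub>Zlam\<^esub> r"
    unfolding PIdl_iff N_def Zl_norm[symmetric] r by (rule bexI) auto
  then have "of_int \<bar>N\<bar> \<in> PIdl\<^bsub>Zlam\<^esub> r" using PIdl_minus by (cases "N \<ge> 0") fastforce+
  then show ?thesis using \<open>N \<noteq> 0\<close> by (intro exI[of _ "nat \<bar>N\<bar>"]) auto
qed

lemma PIdl_2_iff: "of_int a + of_int b * lam \<in> PIdl\<^bsub>Zlam\<^esub> 2 \<longleftrightarrow> even a \<and> even b"
proof
  assume "of_int a + of_int b * lam \<in> PIdl\<^bsub>Zlam\<^esub> 2"
  then obtain c d where "of_int a + of_int b * lam = (of_int c + of_int d * lam) * 2"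
    by (auto simp: PIdl_iff Zl_iff)
  then have "of_int (a - 2 * c) + of_int (b - 2 * d) * lam = 0" by (simp add: algebra_simps)
  from lam_independent[OF this] show "even a \<and> even b" by auto
next
  assume "even a \<and> even b"
  then obtain c d where "a = 2 * c" "b = 2 * d" by (auto elim!: evenE)
  then show "of_int a + of_int b * lam \<in> PIdl\<^bsub>Zlam\<^esub> 2"
    unfolding PIdl_iff by (intro bexI[of _ "of_int c + of_int d * lam"]) auto
qed

text \<open>\<open>lam\<close> is a unit with inverse \<open>lam - 1\<close>.\<close>

lemma PIdl_lam_mult:
  assumes "x * lam \<in> PIdl\<^bsub>Zlam\<^esub> r" shows "x \<in> PIdl\<^bsub>Zlam\<^esub> r"
proof -
  have "x = (lam - 1) * (x * lam)"
  proof -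
    have "x = (l - 1) * (x * l)" if "l * l = l + 1" for l using that by Groebner_Basis.algebra
    from this[OF lam_sq] show ?thesis .
  qed
  moreover have "(lam - 1) * (x * lam) \<in> PIdl\<^bsub>Zlam\<^esub> r"
    using assms by (rule PIdl_mult_left[rotated]) simp
  ultimately show ?thesis by metis
qed

section \<open>Two-by-two matrices in explicit form\<close>

definition M2 :: "real \<Rightarrow> real \<Rightarrow> real \<Rightarrow> real \<Rightarrow> real^2^2" where
  "M2 a b c d = vector [vector [a, b], vector [c, d]]"

lemma M2_nth [simp]:
  "M2 a b c d $ 1 $ 1 = a" "M2 a b c d $ 1 $ 2 = b"
  "M2 a b c d $ 2 $ 1 = c" "M2 a b c d $ 2 $ 2 = d"
  by (simp_all add: M2_def)

lemma M2_cases [cases type]: obtains a b c d where "A = M2 a b c d"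
  by (rule that[of "A$1$1" "A$1$2" "A$2$1" "A$2$2"]) (simp add: vec_eq_iff forall_2)

lemma M2_eq_iff [simp]: "M2 a b c d = M2 a' b' c' d' \<longleftrightarrow> a = a' \<and> b = b' \<and> c = c' \<and> d = d'"
  by (simp add: vec_eq_iff forall_2)

lemma M2_mult [simp]:
  "M2 a b c d ** M2 a' b' c' d' = M2 (a*a'+b*c') (a*b'+b*d') (c*a'+d*c') (c*b'+d*d')"
  by (simp add: vec_eq_iff forall_2 matrix_matrix_mult_def sum_2)

lemma M2_uminus [simp]: "- M2 a b c d = M2 (-a) (-b) (-c) (-d)"
  by (simp add: vec_eq_iff forall_2)

lemma M2_det [simp]: "det (M2 a b c d) = a * d - b * c"
  by (simp add: det_2)

lemma mat_1_M2: "mat 1 = M2 1 0 0 1"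
  by (simp add: vec_eq_iff forall_2 mat_def)

lemma matT_M2: "matT = M2 1 lam 0 1"
  by (simp add: matT_def M2_def)

lemma matS_M2: "matS = M2 0 1 (-1) 0"
  by (simp add: matS_def M2_def)


text \<open>Coordinates in the basis 1, \<open>lam\<close>: with \<open>zl_simps\<close>, explicit
  matrix identities become integer equations that simplification settles.\<close>

definition zl :: "int \<Rightarrow> int \<Rightarrow> real" where
  "zl a b = of_int a + of_int b * lam"

lemma zl_simps:
  "zl a b + zl c d = zl (a + c) (b + d)"
  "zl a b - zl c d = zl (a - c) (b - d)"
  "- zl a b = zl (- a) (- b)"
  "zl a b * zl c d = zl (a * c + b * d) (a * d + b * c + b * d)"
  "zl a b = zl c d \<longleftrightarrow> a = c \<and> b = d"
  "of_int k * zl a b = zl (k * a) (k * b)"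
proof -
  show "zl a b = zl c d \<longleftrightarrow> a = c \<and> b = d"
  proof
    assume "zl a b = zl c d"
    then have "of_int (a - c) + of_int (b - d) * lam = 0" by (simp add: zl_def algebra_simps)
    from lam_independent[OF this] show "a = c \<and> b = d" by simp
  qed simp
  have "(x + y * l) * (z + w * l) = (x * z + y * w) + (x * w + y * z + y * w) * l"
    if "l * l = l + 1" for l x y z w :: real
    using that by Groebner_Basis.algebra
  from this[OF lam_sq] show "zl a b * zl c d = zl (a * c + b * d) (a * d + b * c + b * d)"
    by (simp add: zl_def)
qed (simp_all add: zl_def algebra_simps)

lemma zl_0: "0 = zl 0 0" and zl_1: "1 = zl 1 0" and zl_lam: "lam = zl 0 1"
  and zl_numeral: "numeral k = zl (numeral k) 0"
  by (simp_all add: zl_def)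

section \<open>The group \<open>H5\<close> and normal closures of powers of \<open>T\<close>\<close>

text \<open>The adjugate is the inverse at determinant 1, and its formula makes sense for all
  matrices.\<close>

definition adj :: "real^2^2 \<Rightarrow> real^2^2" where
  "adj A = M2 (A $ 2 $ 2) (- A $ 1 $ 2) (- A $ 2 $ 1) (A $ 1 $ 1)"

lemma adj_M2 [simp]: "adj (M2 a b c d) = M2 d (-b) (-c) a"
  by (simp add: adj_def)

lemma adj_mult: "adj (A ** B) = adj B ** adj A"
  by (cases A; cases B) (simp add: algebra_simps)

lemma adj_adj [simp]: "adj (adj A) = A"
  by (cases A) simp

lemma adj_inverse:
  assumes "det A = 1" shows "A ** adj A = mat 1" "adj A ** A = mat 1"
  using assms by (cases A; simp add: mat_1_M2 algebra_simps)+

lemma det_adj [simp]: "det (adj A) = det A"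
  by (cases A) simp

lemma adj_1 [simp]: "adj (mat 1) = mat 1"
  by (simp add: mat_1_M2)

definition MZ :: "(real^2^2) set" where
  "MZ = {A. \<forall>i j. A $ i $ j \<in> Zl}"

lemma MZ_M2 [simp]: "M2 a b c d \<in> MZ \<longleftrightarrow> a \<in> Zl \<and> b \<in> Zl \<and> c \<in> Zl \<and> d \<in> Zl"
  by (simp add: MZ_def forall_2 conj_assoc)

lemma MZ_1 [simp]: "mat 1 \<in> MZ"
  by (simp add: mat_1_M2)

lemma MZ_mult: "A \<in> MZ \<Longrightarrow> B \<in> MZ \<Longrightarrow> A ** B \<in> MZ"
  by (cases A; cases B) simp

lemma MZ_adj: "A \<in> MZ \<Longrightarrow> adj A \<in> MZ"
  by (cases A) simp

lemma carrier_SL2Zlam: "A \<in> carrier SL2Zlam \<longleftrightarrow> A \<in> MZ \<and> det A = 1"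
  by (simp add: SL2Zlam_def MZ_def)

lemma SL2Zlam_ops [simp]: "x \<otimes>\<^bsub>SL2Zlam\<^esub> y = x ** y" "\<one>\<^bsub>SL2Zlam\<^esub> = mat 1"
  by (simp_all add: SL2Zlam_def)

lemma group_SL2Zlam: "group SL2Zlam"
proof (rule groupI)
  fix x assume x: "x \<in> carrier SL2Zlam"
  show "\<exists>y\<in>carrier SL2Zlam. y \<otimes>\<^bsub>SL2Zlam\<^esub> x = \<one>\<^bsub>SL2Zlam\<^esub>"
    using x by (intro bexI[of _ "adj x"]) (auto simp: carrier_SL2Zlam adj_inverse MZ_adj)
qed (auto simp: carrier_SL2Zlam MZ_mult det_mul matrix_mul_assoc[symmetric])

lemma inv_SL2Zlam: "A \<in> carrier SL2Zlam \<Longrightarrow> inv\<^bsub>SL2Zlam\<^esub> A = adj A"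
  by (rule group.inv_equality[OF group_SL2Zlam])
    (auto simp: carrier_SL2Zlam adj_inverse MZ_adj)

abbreviation H5c :: "(real^2^2) set" where
  "H5c \<equiv> carrier H5"

lemma H5c_def: "H5c = generate SL2Zlam {matS, matT}"
  by (simp add: H5_def)

lemma ST_in_SL2Zlam: "matS \<in> carrier SL2Zlam" "matT \<in> carrier SL2Zlam"
  by (simp_all add: carrier_SL2Zlam matS_M2 matT_M2)

lemma H5c_SL2: "A \<in> H5c \<Longrightarrow> A \<in> carrier SL2Zlam"
  using group.generate_in_carrier[OF group_SL2Zlam, of "{matS, matT}"] ST_in_SL2Zlam
  by (auto simp: H5c_def)

lemma H5c_MZ: "A \<in> H5c \<Longrightarrow> A \<in> MZ" and H5c_det: "A \<in> H5c \<Longrightarrow> det A = 1"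
  using H5c_SL2 by (auto simp: carrier_SL2Zlam)

lemma H5c_1 [simp]: "mat 1 \<in> H5c"
  using generate.one[of SL2Zlam] by (simp add: H5c_def)

lemma H5c_S [simp]: "matS \<in> H5c" and H5c_T [simp]: "matT \<in> H5c"
  by (auto simp: H5c_def intro: generate.incl)

lemma H5c_mult: "A \<in> H5c \<Longrightarrow> B \<in> H5c \<Longrightarrow> A ** B \<in> H5c"
  using generate.eng[of A SL2Zlam _ B] by (simp add: H5c_def)

lemma H5c_adj: "A \<in> H5c \<Longrightarrow> adj A \<in> H5c"
  using group.generate_m_inv_closed[OF group_SL2Zlam, of "{matS, matT}" A] ST_in_SL2Zlam
    inv_SL2Zlam[OF H5c_SL2]
  by (simp add: H5c_def)

lemma H5c_adj_inverse [simp]: "A \<in> H5c \<Longrightarrow> A ** adj A = mat 1" "A \<in> H5c \<Longrightarrow> adj A ** A = mat 1"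
  by (simp_all add: adj_inverse H5c_det)

lemma adj_cancel:
  assumes "A \<in> H5c" shows "A ** (adj A ** B) = B" "adj A ** (A ** B) = B"
  using assms by (simp_all add: matrix_mul_assoc)

text \<open>Inverses are superfluous among the generators because \<open>matS ** matT\<close> has order 5.\<close>

inductive_set ST_monoid :: "(real^2^2) set" where
  one: "mat 1 \<in> ST_monoid"
| S: "A \<in> ST_monoid \<Longrightarrow> A ** matS \<in> ST_monoid"
| T: "A \<in> ST_monoid \<Longrightarrow> A ** matT \<in> ST_monoid"

lemma ST_monoid_mult: "B \<in> ST_monoid \<Longrightarrow> A \<in> ST_monoid \<Longrightarrow> A ** B \<in> ST_monoid"
  by (induction rule: ST_monoid.induct) (auto simp: matrix_mul_assoc intro: ST_monoid.intros)

lemma H5c_eq_ST_monoid: "H5c = ST_monoid"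
proof
  show "ST_monoid \<subseteq> H5c"
  proof
    fix A assume "A \<in> ST_monoid" then show "A \<in> H5c" by induction (auto intro: H5c_mult)
  qed
  have S: "matS \<in> ST_monoid" and T: "matT \<in> ST_monoid" using ST_monoid.S[OF ST_monoid.one] ST_monoid.T[OF ST_monoid.one] by auto
  have invS: "adj matS = matS ** matS ** matS" by (simp add: matS_M2)
  \<comment> \<open>The fifth power of \<open>matS ** matT\<close> is 1, so its fourth power is
    \<open>adj matT ** adj matS\<close>; the final \<open>matS\<close> cancels
    \<open>adj matS\<close>.\<close>
  have invT: "adj matT = (matS ** matT) ** (matS ** matT) ** (matS ** matT) ** (matS ** matT) ** matS"
    by (simp only: matT_M2 matS_M2 M2_mult M2_eq_iff adj_M2) (simp add: zl_0 zl_1 zl_lam zl_simps)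
  show "H5c \<subseteq> ST_monoid"
  proof
    fix A assume "A \<in> H5c"
    then show "A \<in> ST_monoid" unfolding H5c_def
    proof (induction rule: generate.induct)
      case (inv h)
      then have "inv\<^bsub>SL2Zlam\<^esub> h = adj h" using ST_in_SL2Zlam inv_SL2Zlam by blast
      moreover have "adj h \<in> ST_monoid" using inv S T by (auto simp only: insert_iff empty_iff invS invT intro!: ST_monoid_mult)
      ultimately show ?case by simp
    qed (use S T in \<open>auto intro: ST_monoid_mult ST_monoid.one\<close>)
  qed
qed

lemma H5c_induct [consumes 1, case_names one S T]:
  assumes "A \<in> H5c" "P (mat 1)"
    "\<And>A. A \<in> H5c \<Longrightarrow> P A \<Longrightarrow> P (A ** matS)" "\<And>A. A \<in> H5c \<Longrightarrow> P A \<Longrightarrow> P (A ** matT)"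
  shows "P A"
  using assms(1) unfolding H5c_eq_ST_monoid
  by (induction rule: ST_monoid.induct) (use assms in \<open>auto simp: H5c_eq_ST_monoid\<close>)

section \<open>Translations, their conjugates and the normal closures\<close>

definition Tz :: "int \<Rightarrow> real^2^2" where
  "Tz k = M2 1 (of_int k * lam) 0 1"

lemma Tz_add: "Tz (a + b) = Tz a ** Tz b"
  by (simp add: Tz_def algebra_simps)

lemma Tz_0: "Tz 0 = mat 1" and Tz_1: "Tz 1 = matT"
  by (simp_all add: Tz_def mat_1_M2 matT_M2)

lemma adj_Tz: "adj (Tz k) = Tz (- k)"
  by (simp add: Tz_def)

lemma Tz_in_H5c [simp]: "Tz k \<in> H5c"
proof -
  have n: "Tz (int n) \<in> H5c" for n
    by (induction n) (auto simp: Tz_0 Tz_1 Tz_add intro: H5c_mult)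
  show ?thesis using n[of "nat k"] H5c_adj[OF n[of "nat (- k)"]]
    by (cases "k \<ge> 0") (auto simp: adj_Tz)
qed

definition conjT :: "real^2^2 \<Rightarrow> int \<Rightarrow> real^2^2" where
  "conjT g k = g ** Tz k ** adj g"

text \<open>Only the first column of the conjugator survives: \<open>b\<close> and \<open>d\<close>
  enter the product through the determinant alone.\<close>

lemma conjT_M2: 
  assumes "a * d - b * c = 1"
  shows "conjT (M2 a b c d) k = M2 (1 - of_int k * lam * (a * c)) (of_int k * lam * (a * a))
     (- of_int k * lam * (c * c)) (1 + of_int k * lam * (a * c))"
  using assms by (simp add: conjT_def Tz_def algebra_simps)

lemma conjT_add: "g \<in> H5c \<Longrightarrow> conjT g (k + l) = conjT g k ** conjT g l"
  by (simp add: conjT_def Tz_add matrix_mul_assoc[symmetric] adj_cancel)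

lemma conjT_0: "g \<in> H5c \<Longrightarrow> conjT g 0 = mat 1"
  by (simp add: conjT_def Tz_0)

lemma adj_conjT: "adj (conjT g k) = conjT g (- k)"
  by (simp add: conjT_def adj_mult adj_Tz matrix_mul_assoc)

lemma conjT_mult: "conjT (g ** h) k = g ** conjT h k ** adj g"
  by (simp add: conjT_def adj_mult matrix_mul_assoc)

lemma conjT_in_H5c: "g \<in> H5c \<Longrightarrow> conjT g k \<in> H5c"
  by (simp add: conjT_def H5c_mult H5c_adj)

text \<open>\<open>k\<close> runs over all multiples of \<open>M\<close>, negative ones included, so
  these products are closed under inverses and form the whole normal closure.\<close>

inductive_set Delta :: "int \<Rightarrow> (real^2^2) set" for M :: int where
  one: "mat 1 \<in> Delta M"
| step: "A \<in> Delta M \<Longrightarrow> g \<in> H5c \<Longrightarrow> M dvd k \<Longrightarrow> A ** conjT g k \<in> Delta M"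

lemma Delta_conjT: "g \<in> H5c \<Longrightarrow> M dvd k \<Longrightarrow> conjT g k \<in> Delta M"
  using Delta.step[OF Delta.one] by simp

lemma Delta_H5c: "A \<in> Delta M \<Longrightarrow> A \<in> H5c"
  by (induction rule: Delta.induct) (auto intro: H5c_mult conjT_in_H5c)

lemma Delta_mult: "B \<in> Delta M \<Longrightarrow> A \<in> Delta M \<Longrightarrow> A ** B \<in> Delta M"
  by (induction rule: Delta.induct) (auto simp: matrix_mul_assoc intro: Delta.intros)

lemma Delta_mono: "A \<in> Delta M \<Longrightarrow> M' dvd M \<Longrightarrow> A \<in> Delta M'"
  by (induction rule: Delta.induct) (auto intro: Delta.intros dvd_trans)

section \<open>Congruence of matrices modulo a rational integer\<close>

definition mcong :: "int \<Rightarrow> real^2^2 \<Rightarrow> real^2^2 \<Rightarrow> bool" where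
  "mcong N A B \<longleftrightarrow> (\<forall>i j. A $ i $ j - B $ i $ j \<in> PIdl\<^bsub>Zlam\<^esub> (of_int N))"

lemma mcong_M2 [simp]: "mcong N (M2 a b c d) (M2 a' b' c' d') \<longleftrightarrow>
    a - a' \<in> PIdl\<^bsub>Zlam\<^esub> (of_int N) \<and> b - b' \<in> PIdl\<^bsub>Zlam\<^esub> (of_int N) \<and>
    c - c' \<in> PIdl\<^bsub>Zlam\<^esub> (of_int N) \<and> d - d' \<in> PIdl\<^bsub>Zlam\<^esub> (of_int N)"
  by (simp add: mcong_def forall_2 conj_assoc)

lemma mcong_refl [simp]: "mcong N A A"
  by (simp add: mcong_def)

lemma mcong_sym: "mcong N A B \<Longrightarrow> mcong N B A"
  unfolding mcong_def by (metis PIdl_minus minus_diff_eq)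

lemma mcong_trans:
  assumes "mcong N A B" "mcong N B C" shows "mcong N A C"
  unfolding mcong_def
proof (intro allI)
  fix i j
  have "(A $ i $ j - B $ i $ j) + (B $ i $ j - C $ i $ j) \<in> PIdl\<^bsub>Zlam\<^esub> (of_int N)"
    using assms by (intro PIdl_add) (auto simp: mcong_def)
  then show "A $ i $ j - C $ i $ j \<in> PIdl\<^bsub>Zlam\<^esub> (of_int N)" by simp
qed

lemma mcong_dvd: "mcong N A B \<Longrightarrow> M dvd N \<Longrightarrow> mcong M A B"
  unfolding mcong_def using PIdl_int_dvd by blast

lemma mcong_coprime: "mcong M A B \<Longrightarrow> mcong N A B \<Longrightarrow> coprime M N \<Longrightarrow> mcong (M * N) A B"
  unfolding mcong_def using PIdl_coprime by blast

lemma PIdl_mult_cong: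
  assumes "x - x' \<in> PIdl\<^bsub>Zlam\<^esub> r" "y - y' \<in> PIdl\<^bsub>Zlam\<^esub> r" "x \<in> Zl" "y' \<in> Zl"
  shows "x * y - x' * y' \<in> PIdl\<^bsub>Zlam\<^esub> r"
proof -
  have "x * y - x' * y' = x * (y - y') + (x - x') * y'" by (simp add: algebra_simps)
  then show ?thesis using assms by (auto intro!: PIdl_add intro: PIdl_mult_left PIdl_mult_right)
qed

lemma PIdl_add_cong:
  assumes "x - x' \<in> PIdl\<^bsub>Zlam\<^esub> r" "y - y' \<in> PIdl\<^bsub>Zlam\<^esub> r"
  shows "(x + y) - (x' + y') \<in> PIdl\<^bsub>Zlam\<^esub> r"
  using PIdl_add[OF assms] by (simp add: algebra_simps)

lemma mcong_mult:
  assumes "mcong N A A'" "mcong N B B'" "A \<in> MZ" "B' \<in> MZ"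
  shows "mcong N (A ** B) (A' ** B')"
  using assms by (cases A; cases A'; cases B; cases B') (auto intro!: PIdl_add_cong PIdl_mult_cong)

lemma conjT_mcong:
  assumes "g \<in> H5c" "N dvd k - l" shows "mcong N (conjT g k) (conjT g l)"
proof -
  have "of_int k * lam - of_int l * lam \<in> PIdl\<^bsub>Zlam\<^esub> (of_int N)"
  proof -
    obtain c where c: "k - l = N * c" using assms(2) by auto
    have "of_int k * lam - of_int l * lam = of_int (k - l) * lam" by (simp add: algebra_simps)
    also have "\<dots> = (of_int c * lam) * of_int N" by (simp add: c)
    finally show ?thesis unfolding PIdl_iff by (intro bexI[of _ "of_int c * lam"]) auto
  qed
  then have "mcong N (Tz k) (Tz l)" by (simp add: Tz_def)
  then show ?thesis using assms unfolding conjT_def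
    by (intro mcong_mult) (auto intro!: H5c_MZ H5c_mult H5c_adj)
qed

lemma Delta_mcong: "A \<in> Delta M \<Longrightarrow> mcong M A (mat 1)"
proof (induction rule: Delta.induct)
  case (step A g k)
  have "mcong M (conjT g k) (mat 1)" using conjT_mcong[of g M k 0] step by (simp add: conjT_0)
  with step have "mcong M (A ** conjT g k) (mat 1 ** mat 1)"
    by (intro mcong_mult) (auto intro: H5c_MZ Delta_H5c)
  then show ?case by simp
qed simp

text \<open>Replacing every \<open>Tz k\<close> by \<open>Tz (a * k)\<close> in a word: this moves an element of a normal
  closure into a smaller one without changing it modulo \<open>q\<close>.\<close>

lemma Delta_scale:
  assumes "A \<in> Delta d" "q dvd a - 1"
  shows "\<exists>B\<in>Delta (d * a). mcong q A B"
  using assms(1)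
proof (induction rule: Delta.induct)
  case one
  show ?case by (rule bexI[of _ "mat 1"]) (auto intro: Delta.one)
next
  case (step A g k)
  then obtain B where B: "B \<in> Delta (d * a)" "mcong q A B" by blast
  have "q dvd k - a * k" using assms(2) by (metis dvd_minus_iff dvd_mult2 left_diff_distrib minus_diff_eq mult_1)
  then have "mcong q (A ** conjT g k) (B ** conjT g (a * k))"
    using step B by (intro mcong_mult conjT_mcong) (auto intro: H5c_MZ Delta_H5c conjT_in_H5c)
  moreover have "B ** conjT g (a * k) \<in> Delta (d * a)"
    using B step by (intro Delta.step) (auto simp: mult.commute)
  ultimately show ?case by blast
qed

definition H_int :: "int \<Rightarrow> (real^2^2) set" where
  "H_int N = {A \<in> H5c. mcong N A (mat 1)}"

lemma H_pr_eq_H_int: "H_pr (of_int N) = H_int N"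
  by (simp add: H_pr_def H_int_def mcong_def)

lemma H_int_quotient:
  assumes "A \<in> H5c" "B \<in> H5c" "mcong N A B" shows "adj A ** B \<in> H_int N"
proof -
  have "mcong N (adj A ** A) (adj A ** B)" using assms by (intro mcong_mult) (auto intro: H5c_MZ H5c_adj)
  then show ?thesis using assms by (auto simp: H_int_def intro: mcong_sym H5c_mult H5c_adj)
qed

section \<open>The normal closures of \<open>T\<close> and \<open>T ^ 2\<close>\<close>

text \<open>As \<open>adj matS = - matS\<close>, the right side is \<open>matS\<close> times the
  fifth power of \<open>adj (matS ** matT)\<close>, which is 1. This puts \<open>matS\<close> into
  the normal closure of \<open>matT\<close>.\<close>

lemma matS_eq_conjT: "matS = conjT matS (- 1) ** Tz (- 1) ** conjT matS (- 1) ** Tz (- 1) ** conjT matS (- 1)"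
  by (simp only: matS_M2 conjT_def Tz_def M2_mult adj_M2 M2_eq_iff)
    (simp add: zl_0 zl_1 zl_lam zl_numeral zl_simps)

lemma conjT_1: "conjT (mat 1) k = Tz k"
  by (simp add: conjT_def)

lemma Delta_Tz: "M dvd k \<Longrightarrow> Tz k \<in> Delta M"
  using Delta_conjT[of "mat 1" M k] by (simp add: conjT_1)

lemma Delta_1: "H5c \<subseteq> Delta 1"
proof
  have S: "matS \<in> Delta 1"
    by (subst matS_eq_conjT) (intro Delta_mult Delta_conjT Delta_Tz; simp)
  have T: "matT \<in> Delta 1" using Delta_Tz[of 1 1] by (simp add: Tz_1)
  fix A assume "A \<in> H5c" then show "A \<in> Delta 1"
    by (induction rule: H5c_induct) (auto intro: Delta.one Delta_mult S T)
qed

text \<open>The powers of \<open>matS ** matT\<close>, which has order 5.\<close>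

definition rot :: "(real^2^2) set" where
  "rot = {mat 1, M2 0 1 (-1) (-lam), M2 (-1) (-lam) lam lam, M2 lam lam (-lam) (-1), M2 (-lam) (-1) 1 0}"

lemma rot_step: "R \<in> rot \<Longrightarrow> R ** matS ** matT \<in> rot"
  unfolding rot_def insert_iff empty_iff
  by (elim disjE; simp only: mat_1_M2 matS_M2 matT_M2 M2_mult M2_eq_iff)
    (simp_all add: zl_0 zl_1 zl_lam zl_numeral zl_simps)

lemma rot_step_back: "R \<in> rot \<Longrightarrow> \<exists>R'\<in>rot. R = R' ** matS ** matT"
  unfolding rot_def bex_simps
  by (elim insertE emptyE; simp only: mat_1_M2 matS_M2 matT_M2 M2_mult M2_eq_iff)
    (simp_all add: zl_0 zl_1 zl_lam zl_numeral zl_simps)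

lemma rot_H5c: assumes "R \<in> rot" shows "R \<in> H5c"
proof -
  define r where "r = matS ** matT"
  have r: "r \<in> H5c" by (simp add: r_def H5c_mult)
  have rot: "rot = {mat 1, r, r ** r, r ** r ** r, r ** r ** r ** r}"
    unfolding rot_def r_def 
    by (intro arg_cong2[where f = insert] refl; simp only: matS_M2 matT_M2 M2_mult M2_eq_iff)
      (simp_all add: zl_0 zl_1 zl_lam zl_numeral zl_simps)
  then show "R \<in> H5c" using assms r by (auto simp: rot intro: H5c_mult)
qed

text \<open>From \<open>(matT ** matS) ^ 5 = 1\<close> and \<open>matT ** matS = - Tz 2 ** inverse (matS ** matT)\<close>.\<close>

lemma uminus_1_eq: "- mat 1 = Tz 2 ** conjT (M2 (-lam) (-1) 1 0) 2 ** conjT (M2 lam lam (-lam) (-1)) 2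
  ** conjT (M2 (-1) (-lam) lam lam) 2 ** conjT (M2 0 1 (-1) (-lam)) 2"
  by (simp only: mat_1_M2 conjT_def Tz_def M2_mult adj_M2 M2_eq_iff M2_uminus of_int_numeral)
    (simp add: zl_0 zl_1 zl_lam zl_numeral zl_simps)

lemma uminus_1_in_Delta_2: "- mat 1 \<in> Delta 2"
  unfolding uminus_1_eq
  by (intro Delta_mult Delta_conjT Delta_Tz rot_H5c) (simp_all add: rot_def)

lemma uminus_mult: "(- A) ** B = - (A ** B)" "A ** (- B) = - (A ** B)" for A B :: "real^2^2"
  by (cases A; cases B; simp)+

lemma H5c_uminus: "A \<in> H5c \<Longrightarrow> - A \<in> H5c"
  using H5c_mult[OF Delta_H5c[OF uminus_1_in_Delta_2], of A] by (simp add: uminus_mult)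

lemma Delta_2_uminus: "A \<in> Delta 2 \<Longrightarrow> - A \<in> Delta 2"
  using Delta_mult[of A 2 "- mat 1"] uminus_1_in_Delta_2 by (simp add: uminus_mult)

text \<open>Modulo \<open>Delta 2\<close>, which contains \<open>- mat 1\<close>, both
  \<open>matS\<close> and \<open>matT\<close> square to 1 and their product has fifth power 1. So
  they generate a quotient of the dihedral group of order 10, with rotations \<open>R\<close> and
  reflections \<open>R ** matT\<close>.\<close>

lemma H5c_mod_Delta_2:
  assumes "A \<in> H5c"
  shows "\<exists>D\<in>Delta 2. \<exists>R\<in>rot. A = D ** R \<or> A = D ** R ** matT"
  using assms
proof (induction rule: H5c_induct)
  case one
  show ?case by (intro bexI[of _ "mat 1"]) (auto simp: rot_def intro: Delta.one)
next
  case (S A)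
  then obtain D R where D: "D \<in> Delta 2" and R: "R \<in> rot" and A: "A = D ** R \<or> A = D ** R ** matT"
    by blast
  from A show ?case
  proof
    assume A: "A = D ** R"
    define R' where "R' = R ** matS ** matT"
    have R': "R' \<in> rot" using rot_step R by (simp add: R'_def)
    \<comment> \<open>Write \<open>matS\<close> as \<open>matS ** matT ** Tz (-2) ** matT\<close>;
      the even translation moves to the left of \<open>R'\<close> as a conjugate.\<close>
    have "A ** matS = (D ** conjT R' (-2)) ** R' ** matT"
    proof -
      have S: "matS = matS ** matT ** Tz (-2) ** matT" by (simp add: matS_M2 matT_M2 Tz_def)
      have "A ** matS = D ** (R' ** Tz (-2) ** matT)"
        unfolding A R'_def by (subst S) (simp add: matrix_mul_assoc)
      also have "\<dots> = (D ** conjT R' (-2)) ** R' ** matT"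
        using rot_H5c[OF R'] by (simp add: conjT_def matrix_mul_assoc[symmetric] adj_cancel)
      finally show ?thesis .
    qed
    moreover have "D ** conjT R' (-2) \<in> Delta 2" using D R' rot_H5c by (intro Delta.step) auto
    ultimately show ?thesis using R' by blast
  next
    assume A: "A = D ** R ** matT"
    obtain R' where R': "R' \<in> rot" "R = R' ** matS ** matT" using rot_step_back R by blast
    \<comment> \<open>Modulo \<open>Delta 2\<close>, \<open>matT ** matS\<close> is inverse to
      \<open>matS ** matT\<close>, so the rotation goes back one step, to \<open>R'\<close>.\<close>
    have "A ** matS = - (D ** conjT R 2) ** R'"
    proof -
      have TS: "matS ** matT ** matT ** matS = - (matS ** matT ** Tz 2 ** (adj matT ** adj matS))"
        by (simp add: matS_M2 matT_M2 Tz_def)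
      have "A ** matS = D ** (R' ** (matS ** matT ** matT ** matS))"
        unfolding A R' by (simp add: matrix_mul_assoc)
      also have "\<dots> = - (D ** conjT R 2) ** R'"
        using rot_H5c[OF R'(1)] unfolding TS R'
        by (simp add: conjT_def adj_mult uminus_mult matrix_mul_assoc[symmetric])
      finally show ?thesis .
    qed
    moreover have "- (D ** conjT R 2) \<in> Delta 2" using D R rot_H5c
      by (intro Delta_2_uminus Delta.step) auto
    ultimately show ?thesis using R' by blast
  qed
next
  case (T A)
  then obtain D R where D: "D \<in> Delta 2" and R: "R \<in> rot" and A: "A = D ** R \<or> A = D ** R ** matT"
    by blast
  from A show ?case
  proof
    assume "A = D ** R" then show ?thesis using D R by blast
  next
    assume A: "A = D ** R ** matT"
    have "A ** matT = (D ** conjT R 2) ** R"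
    proof -
      have "A ** matT = D ** (R ** (matT ** matT))" by (simp add: A matrix_mul_assoc)
      also have "matT ** matT = Tz 2" by (simp add: matT_M2 Tz_def)
      also have "D ** (R ** Tz 2) = (D ** conjT R 2) ** R"
        using rot_H5c[OF R] by (simp add: conjT_def matrix_mul_assoc[symmetric])
      finally show ?thesis .
    qed
    moreover have "D ** conjT R 2 \<in> Delta 2" using D R rot_H5c by (intro Delta.step) auto
    ultimately show ?thesis using R by blast
  qed
qed

lemma PIdl_2_zl: "zl a b \<in> PIdl\<^bsub>Zlam\<^esub> (zl 2 0) \<longleftrightarrow> even a \<and> even b"
  using PIdl_2_iff[of a b] by (simp add: zl_def)

lemma rot_mcong_2:
  assumes "R \<in> rot" shows "mcong 2 R (mat 1) \<longrightarrow> R = mat 1"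
  using assms unfolding rot_def insert_iff empty_iff
  by (elim disjE; (hypsubst | simp only:); simp only: mat_1_M2 mcong_M2 M2_eq_iff of_int_numeral)
    (simp_all add: zl_0 zl_1 zl_lam zl_numeral zl_simps PIdl_2_zl)

lemma rot_T_mcong_2:
  assumes "R \<in> rot" shows "\<not> mcong 2 (R ** matT) (mat 1)"
  using assms unfolding rot_def insert_iff empty_iff
  by (elim disjE; (hypsubst | simp only:); simp only: mat_1_M2 matT_M2 M2_mult mcong_M2 of_int_numeral)
    (simp_all add: zl_0 zl_1 zl_lam zl_numeral zl_simps PIdl_2_zl)

text \<open>\<open>Delta 2\<close> is trivial modulo 2, while among the ten representatives in
  \<open>H5c_mod_Delta_2\<close> only 1 is.\<close>

lemma H_int_2: "H_int 2 \<subseteq> Delta 2"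
proof
  fix A assume A: "A \<in> H_int 2"
  then obtain D R where D: "D \<in> Delta 2" and R: "R \<in> rot" and DR: "A = D ** R \<or> A = D ** R ** matT"
    using H5c_mod_Delta_2[of A] unfolding H_int_def by blast
  have eq: "mcong 2 B (mat 1)" if "B \<in> H5c" "A = D ** B" for B
  proof -
    have "mcong 2 (D ** B) (mat 1 ** B)" using D that by (intro mcong_mult Delta_mcong) (auto intro: H5c_MZ Delta_H5c)
    then show ?thesis using A that by (auto simp: H_int_def intro: mcong_sym mcong_trans)
  qed
  from DR show "A \<in> Delta 2"
  proof
    assume "A = D ** R"
    then show ?thesis using eq[of R] rot_mcong_2[OF R] rot_H5c[OF R] D by simp
  next
    assume "A = D ** R ** matT"
    then show ?thesis using eq[of "R ** matT"] rot_T_mcong_2[OF R] rot_H5c[OF R]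
      by (simp add: matrix_mul_assoc H5c_mult)
  qed
qed

section \<open>Principal congruence subgroups and normal closures\<close>

lemma PIdlI: "z \<in> Zl \<Longrightarrow> x = z * r \<Longrightarrow> x \<in> PIdl\<^bsub>Zlam\<^esub> r"
  unfolding PIdl_iff by blast

definition one_plus :: "int \<Rightarrow> real \<Rightarrow> real \<Rightarrow> real \<Rightarrow> real^2^2" where
  "one_plus M x y z = M2 (1 + of_int M * x) (of_int M * y) (of_int M * z) (1 - of_int M * x)"

text \<open>The traceless matrices \<open>X\<close> for which \<open>1 + M X\<close> is, to first order in \<open>M\<close>, in the normal
  closure of \<open>Tz M\<close>, uniformly in \<open>M\<close>.\<close>

definition tangent :: "real \<Rightarrow> real \<Rightarrow> real \<Rightarrow> bool" where
  "tangent x y z \<longleftrightarrow> x \<in> Zl \<and> y \<in> Zl \<and> z \<in> Zl \<and>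
     (\<forall>M r. r dvd M \<longrightarrow> (\<exists>A\<in>Delta M. mcong (M * r) A (one_plus M x y z)))"

text \<open>\<open>conjT g (M * j)\<close> is exactly 1 plus \<open>M\<close> times a nilpotent
  matrix, so there is no higher-order error.\<close>

lemma tangent_conjT:
  assumes "M2 a b c d \<in> H5c"
  shows "tangent (- of_int j * lam * (a * c)) (of_int j * lam * (a * a)) (- of_int j * lam * (c * c))"
  unfolding tangent_def
proof (intro conjI allI impI)
  have Z: "a \<in> Zl" "c \<in> Zl" and det: "a * d - b * c = 1"
    using H5c_MZ[OF assms] H5c_det[OF assms] by simp_all
  show "- of_int j * lam * (a * c) \<in> Zl" "of_int j * lam * (a * a) \<in> Zl" "- of_int j * lam * (c * c) \<in> Zl"
    using Z by simp_all
  fix M r :: int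
  show "\<exists>A\<in>Delta M. mcong (M * r) A (one_plus M (- of_int j * lam * (a * c)) (of_int j * lam * (a * a)) (- of_int j * lam * (c * c)))"
    by (rule bexI[OF _ Delta_conjT[OF assms, of M "M * j"]])
      (simp_all add: conjT_M2[OF det] one_plus_def algebra_simps)
qed

text \<open>\<open>(1 + M X) (1 + M X')\<close> differs from \<open>1 + M (X + X')\<close> by
  \<open>M^2 X X'\<close>, which vanishes modulo \<open>M * r\<close> because \<open>r\<close>
  divides \<open>M\<close>.\<close>

lemma tangent_add:
  assumes "tangent x y z" "tangent x' y' z'" shows "tangent (x + x') (y + y') (z + z')"
  unfolding tangent_def
proof (intro conjI allI impI)
  have Z: "x \<in> Zl" "y \<in> Zl" "z \<in> Zl" "x' \<in> Zl" "y' \<in> Zl" "z' \<in> Zl"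
    using assms by (simp_all add: tangent_def)
  then show "x + x' \<in> Zl" "y + y' \<in> Zl" "z + z' \<in> Zl" by simp_all
  fix M r :: int assume "r dvd M"
  then obtain t where t: "M = r * t" by blast
  obtain A B where A: "A \<in> Delta M" "mcong (M * r) A (one_plus M x y z)"
    and B: "B \<in> Delta M" "mcong (M * r) B (one_plus M x' y' z')"
    using assms \<open>r dvd M\<close> by (meson tangent_def)
  have "mcong (M * r) (A ** B) (one_plus M x y z ** one_plus M x' y' z')"
    using A B Z by (intro mcong_mult) (auto intro: H5c_MZ Delta_H5c simp: one_plus_def)
  moreover have "mcong (M * r) (one_plus M x y z ** one_plus M x' y' z') (one_plus M (x + x') (y + y') (z + z'))"
  proof -
    have I: "e \<in> PIdl\<^bsub>Zlam\<^esub> (of_int (M * r))" if "e = (of_int t * w) * of_int (M * r)" "w \<in> Zl" for e w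
      using that by (intro PIdlI[of "of_int t * w"]) simp_all
    show ?thesis unfolding one_plus_def M2_mult mcong_M2
      using Z
      \<comment> \<open>The witnesses are the entries of \<open>X X'\<close>.\<close>
      by (intro conjI I[of _ "x * x' + y * z'"] I[of _ "x * y' - y * x'"]
          I[of _ "z * x' - x * z'"] I[of _ "z * y' + x * x'"])
        (simp_all add: t algebra_simps)
  qed
  ultimately show "\<exists>A\<in>Delta M. mcong (M * r) A (one_plus M (x + x') (y + y') (z + z'))"
    using A B by (blast intro: mcong_trans Delta_mult)
qed

text \<open>\<open>V3\<close> and \<open>V4\<close> differ only in the sign of the diagonal, and so
  do \<open>V5\<close> and \<open>V6\<close>. Differences leave twice a diagonal matrix, the sum of
  \<open>V3\<close> and \<open>V4\<close> twice an off-diagonal one; hence the factor 2.\<close>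

lemma tangent_double:
  assumes "x \<in> Zl" "y \<in> Zl" "z \<in> Zl" shows "tangent (2 * x) (2 * y) (2 * z)"
proof -
  have zl: "of_int j = zl j 0" for j by (simp add: zl_def)
  note S = zl zl_0 zl_1 zl_lam zl_numeral zl_simps
  have V1: "tangent (zl 0 0) (zl 0 j) (zl 0 0)" for j
    using tangent_conjT[of 1 0 0 1 j] by (simp add: mat_1_M2[symmetric]) (simp add: S)
  have V2: "tangent (zl 0 0) (zl 0 0) (zl 0 j)" for j
    using tangent_conjT[of 0 1 "-1" 0 "-j"] H5c_S by (simp add: matS_M2) (simp add: S)
  have rots: "M2 (-1) (-lam) lam lam \<in> H5c" "M2 lam lam (-lam) (-1) \<in> H5c"
    by (rule rot_H5c, simp add: rot_def)+
  have V3: "tangent (zl (-j) (-j)) (zl j (2 * j)) (zl 0 (-j))" for j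
  proof -
    have "M2 (-lam) 1 (-1) 0 \<in> H5c"
      using H5c_mult[OF H5c_T H5c_S] by (simp add: matT_M2 matS_M2)
    from tangent_conjT[OF this, of j] show ?thesis by (simp add: S)
  qed
  have V4: "tangent (zl j j) (zl j (2 * j)) (zl 0 (-j))" for j
  proof -
    have "M2 lam 1 (-1) 0 \<in> H5c"
      using H5c_mult[OF Tz_in_H5c[of "-1"] H5c_S] by (simp add: Tz_def matS_M2)
    from tangent_conjT[OF this, of j] show ?thesis by (simp add: S)
  qed
  have V5: "tangent (zl j (2 * j)) (zl j (2 * j)) (zl (- j) (- (2 * j)))" for j
    using tangent_conjT[OF rots(2), of j] by (simp add: S)
  have V6: "tangent (zl (- j) (- (2 * j))) (zl j (2 * j)) (zl (- j) (- (2 * j)))" for j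
  proof -
    have "M2 lam 1 lam lam \<in> H5c"
      using H5c_mult[OF H5c_T rots(1)] by (simp add: matT_M2 lam_sq)
    from tangent_conjT[OF this, of j] show ?thesis by (simp add: S)
  qed
  have V7: "tangent (zl j j) (zl 0 j) (zl (- j) (- (2 * j)))" for j
    using tangent_conjT[OF rots(1), of j] by (simp add: S)
  \<comment> \<open>In the basis 1, \<open>lam\<close> the differences have diagonals
    \<open>(2, 2)\<close> and \<open>(2, 4)\<close>; their multiples by \<open>2 * a - b\<close> and
    \<open>b - a\<close> add up to \<open>(2 * a, 2 * b)\<close>.\<close>
  have X: "tangent (zl (2 * a) (2 * b)) (zl 0 0) (zl 0 0)" for a b
    using tangent_add[OF tangent_add[OF V4[of "2 * a - b"] V3[of "b - 2 * a"]]
      tangent_add[OF V5[of "b - a"] V6[of "a - b"]]]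
    by (simp add: zl_simps algebra_simps)
  \<comment> \<open>The diagonals of \<open>V3\<close> and \<open>V4\<close> cancel;
    \<open>V1\<close> adjusts the coefficient of \<open>lam\<close> in the upper right entry and
    \<open>V2\<close> clears the lower left one.\<close>
  have Y: "tangent (zl 0 0) (zl (2 * a) (2 * b)) (zl 0 0)" for a b
    using tangent_add[OF tangent_add[OF V3[of a] V4[of a]]
      tangent_add[OF V1[of "2 * b - 4 * a"] V2[of "2 * a"]]]
    by (simp add: zl_simps algebra_simps)
  \<comment> \<open>\<open>V7\<close> supplies the rational part of the lower left entry;
    \<open>X\<close> removes its diagonal, \<open>V1\<close> its upper right entry, and
    \<open>V2\<close> adjusts the coefficient of \<open>lam\<close>.\<close>
  have W: "tangent (zl 0 0) (zl 0 0) (zl (2 * a) (2 * b))" for a b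
    using tangent_add[OF tangent_add[OF V7[of "- 2 * a"] X[of a a]]
      tangent_add[OF V1[of "2 * a"] V2[of "2 * b - 4 * a"]]]
    by (simp add: zl_simps algebra_simps)
  obtain a b c d e f where abc: "x = zl a b" "y = zl c d" "z = zl e f"
    using assms by (auto simp: Zl_iff zl_def)
  then show ?thesis
    using tangent_add[OF tangent_add[OF X[of a b] Y[of c d]] W[of e f]] by (simp add: S)
qed

text \<open>For \<open>h = 1 + M X\<close>, dividing \<open>det h = 1\<close> by \<open>M\<close>
  makes the trace of \<open>X\<close> a multiple of \<open>M\<close>: to first order
  \<open>X\<close> is traceless.\<close>

lemma H_int_cases:
  assumes "h \<in> H_int M" "M \<noteq> 0"
  obtains x y z w where "x \<in> Zl" "y \<in> Zl" "z \<in> Zl" "w \<in> Zl"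
    "h = M2 (1 + of_int M * x) (of_int M * y) (of_int M * z) (1 + of_int M * w)"
    "x + w = - of_int M * (x * w - y * z)"
proof -
  obtain a b c d where h: "h = M2 a b c d" by (cases h)
  from assms(1) have "mcong M h (mat 1)" and det: "a * d - b * c = 1"
    using H5c_det[of h] by (auto simp: H_int_def h)
  then obtain x y z w where Z: "x \<in> Zl" "y \<in> Zl" "z \<in> Zl" "w \<in> Zl" and
    "a - 1 = x * of_int M" "b = y * of_int M" "c = z * of_int M" "d - 1 = w * of_int M"
    by (auto simp: h mat_1_M2 PIdl_iff)
  then have abcd: "a = 1 + of_int M * x" "b = of_int M * y" "c = of_int M * z" "d = 1 + of_int M * w"
    by (simp_all add: algebra_simps)
  have "of_int M * (x + w + of_int M * (x * w - y * z)) = 0"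
    using det by (simp add: abcd algebra_simps)
  then have "x + w = - of_int M * (x * w - y * z)" using assms(2) by (simp add: add_eq_0_iff2)
  then show thesis using that Z h abcd by blast
qed

text \<open>For odd \<open>r\<close> put \<open>r + 1 = 2 * s\<close>. Then \<open>2 * s * X\<close>
  agrees with \<open>X\<close> modulo \<open>r\<close> and, being twice an integral matrix, is
  reached by \<open>tangent_double\<close>.\<close>

lemma H_int_step_odd:
  assumes "odd r" "r dvd M" "M \<noteq> 0" "h \<in> H_int M"
  shows "\<exists>A\<in>Delta M. mcong (M * r) A h"
proof -
  obtain x y z w where Z: "x \<in> Zl" "y \<in> Zl" "z \<in> Zl" "w \<in> Zl"
    and h: "h = M2 (1 + of_int M * x) (of_int M * y) (of_int M * z) (1 + of_int M * w)"
    and tr: "x + w = - of_int M * (x * w - y * z)"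
    using H_int_cases assms by metis
  obtain s where s: "r + 1 = 2 * s" using assms(1) by (metis evenE odd_add odd_one)
  obtain t where t: "M = r * t" using assms(2) by blast
  have "tangent (2 * (of_int s * x)) (2 * (of_int s * y)) (2 * (of_int s * z))"
    using Z by (intro tangent_double) simp_all
  then obtain A where A: "A \<in> Delta M" 
    "mcong (M * r) A (one_plus M (2 * (of_int s * x)) (2 * (of_int s * y)) (2 * (of_int s * z)))"
    using assms(2) unfolding tangent_def by blast
  have s2: "2 * (of_int s * v) = of_int r * v + v" for v :: real
  proof -
    have "2 * (of_int s * v) = of_int (2 * s) * v" by simp
    also have "\<dots> = of_int r * v + v" unfolding s[symmetric] by (simp add: algebra_simps)
    finally show ?thesis .
  qed
  have I: "e \<in> PIdl\<^bsub>Zlam\<^esub> (of_int (M * r))" if "e = w * of_int (M * r)" "w \<in> Zl" for e w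
    using that by (intro PIdlI[of w]) simp_all
  \<comment> \<open>\<open>h\<close> has \<open>w\<close> in place of \<open>- x\<close>; by the
    trace relation the defect \<open>M * (x + w)\<close> is a multiple of \<open>M * M\<close>,
    hence of \<open>M * r\<close>.\<close>
  have last: "1 - of_int M * (of_int r * x + x) - (1 + of_int M * w)
    = (of_int t * (x * w - y * z) - x) * of_int (M * r)"
  proof -
    have "1 - of_int M * (of_int r * x + x) - (1 + of_int M * w)
      = - of_int M * of_int r * x - of_int M * (x + w)" by (simp add: algebra_simps)
    then show ?thesis unfolding tr using t by (simp add: algebra_simps)
  qed
  have "mcong (M * r) (one_plus M (2 * (of_int s * x)) (2 * (of_int s * y)) (2 * (of_int s * z))) h"
    unfolding one_plus_def h mcong_M2 s2 using Z
    by (intro conjI I[OF last] I[of _ x] I[of _ y] I[of _ z]) (simp_all add: algebra_simps)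
  then show ?thesis using A by (blast intro: mcong_trans)
qed

text \<open>Here \<open>h = 1 + M (2 X)\<close>, and \<open>2 X\<close> falls under
  \<open>tangent_double\<close> directly. The precision is \<open>M * (2 * r)\<close>, so
  \<open>2 * r\<close> has to divide \<open>M\<close>.\<close>

lemma H_int_step_even:
  assumes "2 * r dvd M" "M \<noteq> 0" "h \<in> H_int (2 * M)"
  shows "\<exists>A\<in>Delta M. mcong (2 * M * r) A h"
proof -
  obtain x y z w where Z: "x \<in> Zl" "y \<in> Zl" "z \<in> Zl" "w \<in> Zl"
    and h: "h = M2 (1 + of_int (2 * M) * x) (of_int (2 * M) * y) (of_int (2 * M) * z) (1 + of_int (2 * M) * w)"
    and tr: "x + w = - of_int (2 * M) * (x * w - y * z)"
    using H_int_cases[OF assms(3)] assms(2) by (metis mult_eq_0_iff zero_neq_numeral)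
  obtain t where t: "M = 2 * r * t" using assms(1) by blast
  obtain A where A: "A \<in> Delta M" "mcong (M * (2 * r)) A (one_plus M (2 * x) (2 * y) (2 * z))"
    using assms(1) tangent_double[OF Z(1-3)] unfolding tangent_def by blast
  have last: "1 - of_int M * (2 * x) - (1 + of_int (2 * M) * w)
    = (4 * of_int t * (x * w - y * z)) * of_int (2 * M * r)"
  proof -
    have "1 - of_int M * (2 * x) - (1 + of_int (2 * M) * w) = - of_int (2 * M) * (x + w)"
      by (simp add: algebra_simps)
    then show ?thesis unfolding tr using t by (simp add: algebra_simps)
  qed
  have "mcong (2 * M * r) (one_plus M (2 * x) (2 * y) (2 * z)) h"
    unfolding one_plus_def h mcong_M2 using Z
    by (intro conjI PIdlI[OF _ last]) (simp_all add: algebra_simps)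
  then show ?thesis using A by (auto intro: mcong_trans simp: algebra_simps)
qed

text \<open>Scale the exponents in a word for \<open>h\<close> in \<open>Delta d\<close> by a
  multiple of \<open>M\<close> that is 1 modulo \<open>d * q\<close>. This keeps \<open>h\<close>
  modulo \<open>d * q\<close>, and modulo \<open>M\<close> both matrices are trivial.\<close>

lemma H_int_step_coprime:
  assumes "H_int d \<subseteq> Delta d" "coprime M (d * q)" "h \<in> H_int (d * M)"
  shows "\<exists>A\<in>Delta (d * M). mcong (d * M * q) A h"
proof -
  have h: "h \<in> H5c" "mcong (d * M) h (mat 1)" using assms(3) by (simp_all add: H_int_def)
  then have "h \<in> H_int d" using mcong_dvd[of "d * M" h "mat 1" d] by (simp add: H_int_def)
  then have "h \<in> Delta d" using assms(1) by blast
  obtain u v where uv: "u * M + v * (d * q) = 1"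
    using assms(2) by (metis bezout_int coprime_imp_gcd_eq_1)
  then have "u * M - 1 = (d * q) * (- v)" by (simp add: algebra_simps)
  then have "d * q dvd u * M - 1" by (metis dvd_triv_left)
  then obtain B where B: "B \<in> Delta (d * (u * M))" "mcong (d * q) h B"
    using Delta_scale \<open>h \<in> Delta d\<close> by blast
  have BM: "B \<in> Delta (d * M)" by (rule Delta_mono[OF B(1)]) simp
  have "mcong M B h"
    using mcong_dvd[OF Delta_mcong[OF BM], of M] mcong_dvd[OF h(2), of M] by (auto intro: mcong_trans mcong_sym)
  then have "mcong (M * (d * q)) B h" using B(2) assms(2) by (intro mcong_coprime mcong_sym[OF B(2)])
  then show ?thesis using BM by (auto simp: algebra_simps)
qed

section \<open>From single steps to the inclusions for \<open>H(m)\<close> and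
  \<open>H(2 m)\<close>\<close>

lemma H_int_subset_step:
  assumes "\<And>h. h \<in> H_int M' \<Longrightarrow> \<exists>A\<in>Delta M. mcong N A h"
    and "\<And>A B. A \<in> P \<Longrightarrow> B \<in> P \<Longrightarrow> A ** B \<in> P" "Delta M \<subseteq> P" "H_int N \<subseteq> P"
  shows "H_int M' \<subseteq> P"
proof
  fix h assume h: "h \<in> H_int M'"
  then obtain A where A: "A \<in> Delta M" "mcong N A h" using assms(1) by blast
  \<comment> \<open>The factor \<open>adj A ** h\<close> lies in \<open>H_int N\<close>.\<close>
  then have "A ** (adj A ** h) \<in> P"
    using assms(2-4) h H_int_quotient[of A h N] by (auto simp: H_int_def Delta_H5c)
  then show "h \<in> P" using A by (simp add: adj_cancel Delta_H5c)
qed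

text \<open>Divide \<open>gcd s N\<close> out of \<open>N\<close> until the rest \<open>q\<close> is
  coprime to \<open>s\<close>; each division is paid for by one factor \<open>s\<close>.\<close>

lemma coprime_decomposition:
  fixes N s :: nat
  assumes "N > 0" shows "\<exists>k q. N dvd s ^ k * q \<and> coprime s q"
  using assms
proof (induction N rule: less_induct)
  case (less N)
  show ?case
  proof (cases "coprime s N")
    case True
    then show ?thesis by (intro exI[of _ 0] exI[of _ N]) simp
  next
    case False
    define g where "g = gcd s N"
    then have "g \<noteq> 1" using False by (simp add: coprime_iff_gcd_eq_1)
    moreover have "g dvd N" "g dvd s" by (simp_all add: g_def)
    ultimately obtain N' where N': "N = g * N'" "N' < N" "N' > 0" using less.prems
      by (metis One_nat_def Suc_lessI dvdE mult.commute mult_0_right n_less_m_mult_n nat_0_less_mult_iff)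
    then obtain k q where "N' dvd s ^ k * q" "coprime s q" using less.IH by blast
    then have "N dvd s ^ Suc k * q" using N'(1) \<open>g dvd s\<close> by (simp add: mult_dvd_mono mult.assoc)
    then show ?thesis using \<open>coprime s q\<close> by blast
  qed
qed

lemma H_int_mono: "M dvd N \<Longrightarrow> H_int N \<subseteq> H_int M"
  by (auto simp: H_int_def intro: mcong_dvd)

lemma Delta_antimono: "M dvd N \<Longrightarrow> Delta N \<subseteq> Delta M"
  using Delta_mono by blast

lemma H_int_subset_not_4_dvd:
  fixes m N :: nat
  assumes P: "\<And>A B. A \<in> P \<Longrightarrow> B \<in> P \<Longrightarrow> A ** B \<in> P" 
    and m: "Delta (int m) \<subseteq> P" "\<not> 4 dvd m" and N: "N > 0" "H_int (int N) \<subseteq> P"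
  shows "H_int (int m) \<subseteq> P"
proof -
  \<comment> \<open>\<open>d\<close> is the exact power of 2 in \<open>m\<close>; in both cases
    \<open>H_int d\<close> is contained in \<open>Delta d\<close>.\<close>
  define d where "d = (if even m then 2 else 1 :: nat)"
  obtain s where s: "m = d * s" "odd s"
    using m(2) by (cases "even m") (auto simp: d_def elim!: evenE)
  then have "s > 0" by (auto intro!: Nat.gr0I)
  have d: "H_int (int d) \<subseteq> Delta (int d)"
    using H_int_2 Delta_1 by (auto simp: d_def H_int_def)
  obtain k q where kq: "N dvd s ^ k * q" "coprime s q" using coprime_decomposition N by blast
  have D: "Delta (int (d * s * s ^ k)) \<subseteq> P" for k
    using Delta_antimono[of "int m" "int (d * s * s ^ k)"] m(1) s(1) by auto
  have "coprime s d" using s(2) by (simp add: d_def)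
  then have cop: "coprime (int (s * s ^ k)) (int d * int q)"
    using kq(2) by simp
  have "N dvd d * (s * s ^ k) * q"
    by (rule dvd_trans[OF kq(1)]) (simp add: algebra_simps)
  then have H: "H_int (int d * int (s * s ^ k) * int q) \<subseteq> P"
    using H_int_mono[of "int N" "int (d * (s * s ^ k) * q)"] N(2) by (auto simp del: of_nat_mult simp flip: of_nat_mult)
  \<comment> \<open>The coprime step discards \<open>q\<close>. The extra factor \<open>s\<close>
    keeps the modulus a multiple of \<open>m\<close>, so its normal closure lies in
    \<open>P\<close>.\<close>
  have "H_int (int d * int (s * s ^ k)) \<subseteq> P"
  proof (rule H_int_subset_step)
    show "\<exists>A\<in>Delta (int d * int (s * s ^ k)). mcong (int d * int (s * s ^ k) * int q) A h"
      if "h \<in> H_int (int d * int (s * s ^ k))" for h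
      using H_int_step_coprime[OF d cop that] .
    show "Delta (int d * int (s * s ^ k)) \<subseteq> P" using D[of k] by (simp add: mult.assoc)
  qed (use P H in auto)
  then have "H_int (int (d * s * s ^ k)) \<subseteq> P" by (simp add: mult.assoc)
  \<comment> \<open>Odd steps with \<open>r = s\<close> now lower the exponent of \<open>s\<close>
    one at a time.\<close>
  then have "H_int (int (d * s)) \<subseteq> P"
  proof (induction k)
    case (Suc k)
    have "H_int (int (d * s * s ^ k)) \<subseteq> P"
    proof (rule H_int_subset_step[OF _ P D])
      show "H_int (int (d * s * s ^ k) * int s) \<subseteq> P" using Suc.prems by (simp add: algebra_simps)
      show "\<exists>A\<in>Delta (int (d * s * s ^ k)). mcong (int (d * s * s ^ k) * int s) A h"
        if "h \<in> H_int (int (d * s * s ^ k))" for h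
        using s(2) \<open>s > 0\<close> that by (intro H_int_step_odd) (auto simp: d_def)
    qed
    then show ?case by (rule Suc.IH)
  qed simp
  then show ?thesis by (simp add: s)
qed

lemma H_int_subset_4_dvd:
  fixes m N :: nat
  assumes P: "\<And>A B. A \<in> P \<Longrightarrow> B \<in> P \<Longrightarrow> A ** B \<in> P" 
    and m: "Delta (int m) \<subseteq> P" "4 dvd m" "m > 0" and N: "N > 0" "H_int (int N) \<subseteq> P"
  shows "H_int (int (2 * m)) \<subseteq> P"
proof -
  \<comment> \<open>\<open>H_int_step_even\<close> with \<open>r = s\<close> asks that
    \<open>2 * s\<close> divide the modulus. As 4 divides \<open>m\<close>, this \<open>s\<close> is
    still even, so \<open>q\<close> is odd and coprime to \<open>2 * m * s ^ k\<close>.\<close>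
  define s where "s = m div 2"
  have s: "m = 2 * s" "even s" "s > 0" using m(2,3) by (auto simp: s_def elim!: dvdE)
  obtain k q where kq: "N dvd s ^ k * q" "coprime s q" using coprime_decomposition N by blast
  have D: "Delta (int (m * s ^ k)) \<subseteq> P" for k
    using Delta_antimono[of "int m" "int (m * s ^ k)"] m(1) by auto
  have D2: "Delta (int (2 * m * s ^ k)) \<subseteq> P" for k
    using Delta_antimono[of "int m" "int (2 * m * s ^ k)"] m(1) by auto
  have "coprime 2 q" using kq(2) s(2) by (meson coprime_divisors dvd_refl)
  then have cop: "coprime (int (2 * m * s ^ k)) (1 * int q)"
    using kq(2) coprime_power_left_iff[of 2 2 "int q"] \<open>coprime 2 q\<close> by (simp add: s(1))
  \<comment> \<open>The coprime step is taken with \<open>d = 1\<close>.\<close>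
  have one: "H_int 1 \<subseteq> Delta 1" using Delta_1 by (auto simp: H_int_def)
  have "N dvd (2 * m * s ^ k) * q"
    by (rule dvd_trans[OF kq(1)]) (simp add: algebra_simps)
  then have H: "H_int (1 * int (2 * m * s ^ k) * int q) \<subseteq> P"
    using H_int_mono[of "int N" "int ((2 * m * s ^ k) * q)"] N(2) by (auto simp del: of_nat_mult simp flip: of_nat_mult)
  have "H_int (1 * int (2 * m * s ^ k)) \<subseteq> P"
  proof (rule H_int_subset_step)
    show "\<exists>A\<in>Delta (1 * int (2 * m * s ^ k)). mcong (1 * int (2 * m * s ^ k) * int q) A h"
      if "h \<in> H_int (1 * int (2 * m * s ^ k))" for h
      using H_int_step_coprime[OF one cop that] .
    show "Delta (1 * int (2 * m * s ^ k)) \<subseteq> P" using D2[of k] by simp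
  qed (use P H in auto)
  then have "H_int (2 * int (m * s ^ k)) \<subseteq> P" by (simp add: mult.assoc)
  then have "H_int (2 * int m) \<subseteq> P"
  proof (induction k)
    case (Suc k)
    have "H_int (2 * int (m * s ^ k)) \<subseteq> P"
    proof (rule H_int_subset_step[OF _ P D])
      show "H_int (2 * int (m * s ^ k) * int s) \<subseteq> P" using Suc.prems by (simp add: algebra_simps)
      show "\<exists>A\<in>Delta (int (m * s ^ k)). mcong (2 * int (m * s ^ k) * int s) A h"
        if "h \<in> H_int (2 * int (m * s ^ k))" for h
        using s m(3) that by (intro H_int_step_even) auto
    qed
    then show ?case by (rule Suc.IH)
  qed simp
  then show ?thesis by simp
qed

section \<open>Cusps and levels\<close>

text \<open>Up to sign, the four generators are \<open>V ^ i ** matS\<close> for \<open>0 < i < 5\<close>, where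
  \<open>V = - matT ** matS\<close> has order 5 modulo the sign.\<close>

inductive_set nonneg_monoid :: "(real^2^2) set" where
  one: "mat 1 \<in> nonneg_monoid"
| step: "A \<in> nonneg_monoid \<Longrightarrow> B \<in> {matT, M2 lam lam 1 lam, M2 lam 1 lam lam, M2 1 0 lam 1} \<Longrightarrow> A ** B \<in> nonneg_monoid"

text \<open>All generators have nonnegative entries. A zero at the lower left survives only
  multiplication by \<open>matT\<close>, which fixes the first column; a zero at the upper right
  only by \<open>M2 1 0 lam 1\<close>, which fixes the second.\<close>

lemma nonneg_monoid_stable:
  assumes "A \<in> nonneg_monoid"
  shows "A $ 1 $ 1 \<ge> 0 \<and> A $ 1 $ 2 \<ge> 0 \<and> A $ 2 $ 1 \<ge> 0 \<and> A $ 2 $ 2 \<ge> 0 \<and> det A = 1 \<and>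
    (A $ 2 $ 1 = 0 \<longrightarrow> A $ 1 $ 1 = 1) \<and> (A $ 1 $ 2 = 0 \<longrightarrow> A $ 2 $ 2 = 1)"
  using assms
proof (induction rule: nonneg_monoid.induct)
  case one
  show ?case by (simp add: mat_1_M2)
next
  case (step A B)
  obtain a b c d where A: "A = M2 a b c d" by (cases A)
  have pos: "a \<ge> 0" "b \<ge> 0" "c \<ge> 0" "d \<ge> 0" "a * d - b * c = 1" "c = 0 \<longrightarrow> a = 1" "b = 0 \<longrightarrow> d = 1"
    using step.IH by (simp_all add: A)
  then have nz: "a \<noteq> 0 \<or> b \<noteq> 0" "c \<noteq> 0 \<or> d \<noteq> 0" by auto
  have "det B = 1" using step.hyps(2) lam_sq by (auto simp: matT_M2)
  then have "det (A ** B) = 1" using step.IH by (simp add: det_mul)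
  moreover have "(A ** B) $ 1 $ 1 \<ge> 0 \<and> (A ** B) $ 1 $ 2 \<ge> 0 \<and> (A ** B) $ 2 $ 1 \<ge> 0 \<and> (A ** B) $ 2 $ 2 \<ge> 0 \<and>
    ((A ** B) $ 2 $ 1 = 0 \<longrightarrow> (A ** B) $ 1 $ 1 = 1) \<and> ((A ** B) $ 1 $ 2 = 0 \<longrightarrow> (A ** B) $ 2 $ 2 = 1)"
    using step.hyps(2)
  proof (elim insertE emptyE)
  qed (use nz pos(1-4,6,7) lam_pos in \<open>simp_all add: A matT_M2 add_nonneg_eq_0_iff\<close>, auto)
  ultimately show ?case by blast
qed

text \<open>Modulo sign \<open>matS\<close> and \<open>V\<close> have orders 2 and 5, so a word
  reduces to nontrivial powers of \<open>V\<close> alternating with \<open>matS\<close>. Grouping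
  each power with the \<open>matS\<close> after it leaves at most one \<open>matS\<close> over at
  either end.\<close>

lemma H5c_normal_form:
  assumes "A \<in> H5c"
  shows "\<exists>W\<in>nonneg_monoid. \<exists>L\<in>{mat 1, matS}. \<exists>R\<in>{mat 1, matS}. A = L ** W ** R \<or> A = - (L ** W ** R)"
    (is "?nf A")
  using assms
proof (induction rule: H5c_induct)
  case one
  show ?case using nonneg_monoid.one by force
next
  case (S A)
  have SS: "X ** matS ** matS = - X" for X :: "real^2^2" by (cases X rule: M2_cases) (simp add: matS_M2)
  from S obtain W L R where W: "W \<in> nonneg_monoid" and L: "L \<in> {mat 1, matS}" and R: "R \<in> {mat 1, matS}"
    and A: "A = L ** W ** R \<or> A = - (L ** W ** R)" by blast
  from R A have "A ** matS = L ** W ** matS \<or> A ** matS = - (L ** W ** matS)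
      \<or> A ** matS = L ** W ** mat 1 \<or> A ** matS = - (L ** W ** mat 1)"
    by (auto simp: SS uminus_mult)
  then show ?case using W L by blast
next
  case (T A)
  have nfI: "?nf B" if "X \<in> nonneg_monoid" "L \<in> {mat 1, matS}" "R \<in> {mat 1, matS}"
    "B = L ** X ** R \<or> B = - (L ** X ** R)" for B X L R
    using that by blast
  from T obtain W L R where W: "W \<in> nonneg_monoid" and L: "L \<in> {mat 1, matS}" and R: "R \<in> {mat 1, matS}"
    and A: "A = L ** W ** R \<or> A = - (L ** W ** R)" by blast
  have TN: "matT \<in> nonneg_monoid" using nonneg_monoid.step[OF nonneg_monoid.one, of matT] by simp
  from R show ?case
  proof (elim insertE emptyE)
    assume "R = mat 1"
    then show ?thesis using A W L nonneg_monoid.step[OF W, of matT]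
      by (intro nfI[of "W ** matT" L "mat 1"]) (auto simp: uminus_mult matrix_mul_assoc)
  next
    assume R: "R = matS"
    have eq: "A ** matT = L ** (W ** matS ** matT) \<or> A ** matT = - (L ** (W ** matS ** matT))"
      using A R by (auto simp: uminus_mult matrix_mul_assoc)
    from W show ?thesis
    proof cases
      case one
      from L show ?thesis
      proof (elim insertE emptyE)
        assume "L = mat 1"
        then show ?thesis using eq one TN by (intro nfI[of matT matS "mat 1"]) auto
      next
        assume L: "L = matS"
        have "matS ** (matS ** matT) = - matT" by (simp add: matS_M2 matT_M2)
        then show ?thesis using eq one L TN by (intro nfI[of matT "mat 1" "mat 1"]) auto
      qed
    next
      case (step W' B)
      let ?A2 = "M2 lam lam 1 lam" and ?A3 = "M2 lam 1 lam lam" and ?A4 = "M2 1 0 lam 1"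
      \<comment> \<open>Since \<open>matT = V ** matS\<close>, right multiplication by
        \<open>matS ** matT\<close> raises the exponent in \<open>V ^ i ** matS\<close> by one up to
        sign; after \<open>i = 4\<close> only \<open>matS\<close> is left.\<close>
      have shift: "matT ** matS ** matT = - ?A2" "?A2 ** matS ** matT = - ?A3"
        "?A3 ** matS ** matT = - ?A4" "?A4 ** matS ** matT = matS"
        by (simp_all add: matS_M2 matT_M2 lam_sq)
      have eq': "A ** matT = L ** (W' ** (B ** matS ** matT)) \<or> A ** matT = - (L ** (W' ** (B ** matS ** matT)))"
        using eq step(1) by (simp add: matrix_mul_assoc)
      have next': "?nf (A ** matT)"
        if "B ** matS ** matT = - C" "C \<in> {matT, ?A2, ?A3, ?A4}" for C
        using eq' that L nonneg_monoid.step[OF step(2) that(2)]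
        by (intro nfI[of "W' ** C" L "mat 1"]) (auto simp: uminus_mult)
      from step(3) show ?thesis
      proof (elim insertE emptyE)
        assume "B = ?A4"
        then show ?thesis using eq' step(2) L shift(4)
          by (intro nfI[of W' L matS]) (auto simp: matrix_mul_assoc)
      next
        assume B: "B = matT"
        show ?thesis by (rule next'[of ?A2]) (simp_all only: B shift insert_iff simp_thms)
      next
        assume B: "B = ?A2"
        show ?thesis by (rule next'[of ?A3]) (simp_all only: B shift insert_iff simp_thms)
      next
        assume B: "B = ?A3"
        show ?thesis by (rule next'[of ?A4]) (simp_all only: B shift insert_iff simp_thms)
      qed
    qed
  qed
qed

text \<open>Up to sign the lower left entry is an entry of the nonnegative matrix \<open>W\<close>.
  Diagonal entries of \<open>W\<close> are nonzero since \<open>a * d = 1 + b * c\<close>, and a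
  zero off the diagonal forces the relevant diagonal entry to be 1. So no other unit of Z[lambda]
  occurs.\<close>

lemma H5c_stabiliser:
  assumes "A \<in> H5c" "A $ 2 $ 1 = 0" shows "A $ 1 $ 1 = 1 \<or> A $ 1 $ 1 = - 1"
proof -
  obtain W L R where W: "W \<in> nonneg_monoid" and L: "L \<in> {mat 1, matS}" and R: "R \<in> {mat 1, matS}"
    and A: "A = L ** W ** R \<or> A = - (L ** W ** R)" using H5c_normal_form[OF assms(1)] by blast
  obtain a b c d where W': "W = M2 a b c d" by (cases W)
  have pos: "a \<ge> 0" "b \<ge> 0" "c \<ge> 0" "d \<ge> 0" "a * d - b * c = 1" "c = 0 \<longrightarrow> a = 1" "b = 0 \<longrightarrow> d = 1"
    using nonneg_monoid_stable[OF W] by (simp_all add: W')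
  have bc: "b * c \<ge> 0" using pos by simp
  have ad: "a \<noteq> 0" "d \<noteq> 0"
    using pos(5) bc by (auto simp del: mult_nonneg_nonneg)
  show ?thesis using L R A assms(2) pos(6,7) ad by (auto simp: W' matS_M2)
qed

lemma conjT_stabiliser:
  assumes "h \<in> H5c" "h $ 2 $ 1 = 0" shows "conjT h k = Tz k"
proof -
  obtain a b c d where h: "h = M2 a b c d" by (cases h)
  have "a * d - b * c = 1" "c = 0" "a = 1 \<or> a = - 1"
    using H5c_det[OF assms(1)] H5c_stabiliser[OF assms] assms(2) by (simp_all add: h)
  then show ?thesis by (auto simp: h conjT_M2 Tz_def)
qed

section \<open>The Moebius action and the stabilisers of cusps\<close>

definition ratio_pt :: "real \<Rightarrow> real \<Rightarrow> real option" where
  "ratio_pt u v = (if v = 0 then None else Some (u / v))"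

text \<open>In homogeneous coordinates the action is linear, which avoids separate treatment of
  infinity later.\<close>

lemma moebius_ratio_pt:
  assumes "u \<noteq> 0 \<or> v \<noteq> 0"
  shows "moebius (M2 a b c d) (ratio_pt u v) = ratio_pt (a * u + b * v) (c * u + d * v)"
proof (cases "v = 0")
  case True
  then show ?thesis using assms by (simp add: ratio_pt_def)
next
  case False
  then have "c * (u / v) + d = (c * u + d * v) / v" "a * (u / v) + b = (a * u + b * v) / v"
    by (simp_all add: field_simps)
  then show ?thesis using False by (simp add: ratio_pt_def)
qed

lemma ratio_pt_cases: obtains u v where "x = ratio_pt u v" "u \<noteq> 0 \<or> v \<noteq> 0"
proof (cases x)
  case None
  then show thesis by (intro that[of 1 0]) (simp_all add: ratio_pt_def)
next
  case (Some y)
  then show thesis by (intro that[of y 1]) (simp_all add: ratio_pt_def)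
qed

lemma moebius_mult:
  assumes "det B = 1" shows "moebius (A ** B) x = moebius A (moebius B x)"
proof -
  obtain a b c d where A: "A = M2 a b c d" by (cases A)
  obtain e f g h where B: "B = M2 e f g h" by (cases B)
  obtain u v where x: "x = ratio_pt u v" and uv: "u \<noteq> 0 \<or> v \<noteq> 0" by (rule ratio_pt_cases)
  have det: "e * h - f * g = 1" using assms by (simp add: B)
  have "e * u + f * v \<noteq> 0 \<or> g * u + h * v \<noteq> 0"
  proof (rule ccontr)
    assume "\<not> ?thesis"
    then have 0: "e * u + f * v = 0" "g * u + h * v = 0" by auto
    have "u = h * (e * u + f * v) - f * (g * u + h * v)" "v = e * (g * u + h * v) - g * (e * u + f * v)"
      using det by Groebner_Basis.algebra+
    then have "u = 0" "v = 0" unfolding 0 by simp_all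
    then show False using uv by simp
  qed
  then show ?thesis by (simp add: A B x moebius_ratio_pt[OF uv] moebius_ratio_pt algebra_simps)
qed

lemma moebius_uminus: "moebius (- A) x = moebius A x"
proof -
  obtain u v where x: "x = ratio_pt u v" and uv: "u \<noteq> 0 \<or> v \<noteq> 0" by (rule ratio_pt_cases)
  obtain a b c d where A: "A = M2 a b c d" by (cases A)
  have "ratio_pt (- s) (- t) = ratio_pt s t" for s t by (simp add: ratio_pt_def)
  from this[of "a * u + b * v" "c * u + d * v"] show ?thesis by (simp add: A x moebius_ratio_pt[OF uv])
qed

lemma moebius_1: "moebius (mat 1) x = x"
proof -
  obtain u v where x: "x = ratio_pt u v" and uv: "u \<noteq> 0 \<or> v \<noteq> 0" by (rule ratio_pt_cases)
  then show ?thesis by (simp add: mat_1_M2 moebius_ratio_pt[OF uv])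
qed

declare moebius.simps [simp del]

lemma moebius_conjT:
  assumes "g \<in> H5c" shows "moebius (conjT g k) (moebius g None) = moebius g None"
proof -
  have "moebius (conjT g k) (moebius g None) = moebius (conjT g k ** g) None"
    using assms by (simp add: moebius_mult H5c_det)
  also have "conjT g k ** g = g ** Tz k"
    using assms by (simp add: conjT_def flip: matrix_mul_assoc)
  also have "moebius (g ** Tz k) None = moebius g (moebius (Tz k) None)"
    by (rule moebius_mult) (simp add: Tz_def)
  finally show ?thesis by (simp add: Tz_def moebius.simps)
qed

text \<open>The width admits any conjugate of \<open>T ^ w\<close> fixing the cusp; only the
  expected one exists. For \<open>h = adj A ** B\<close>, \<open>conjT h w\<close> fixes infinity,
  hence so does \<open>h\<close>, which then commutes with translations.\<close>

lemma conjT_fixes_cusp: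
  assumes "A \<in> H5c" "B \<in> H5c" "w > 0"
    and fix_: "moebius (conjT B w) (moebius A None) = moebius A None"
  shows "conjT B w = conjT A w"
proof -
  define h where "h = adj A ** B"
  have h: "h \<in> H5c" and B: "B = A ** h" using assms by (simp_all add: h_def H5c_mult H5c_adj adj_cancel)
  obtain a b c d where h': "h = M2 a b c d" by (cases h)
  have det: "a * d - b * c = 1" using H5c_det[OF h] by (simp add: h')
  have "conjT h w = adj A ** (conjT B w ** A)"
    using assms by (simp add: h_def conjT_mult matrix_mul_assoc)
  then have "moebius (conjT h w) None = moebius (adj A) (moebius (conjT B w) (moebius A None))"
    using assms by (simp add: moebius_mult H5c_det H5c_mult conjT_in_H5c)
  also have "\<dots> = moebius (adj A ** A) None" using assms
    by (simp add: fix_ moebius_mult H5c_det del: H5c_adj_inverse)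
  also have "\<dots> = None" using assms by (simp add: moebius_1)
  \<comment> \<open>The lower left entry of \<open>conjT h w\<close> is
    \<open>- w * lam * (c * c)\<close>.\<close>
  finally have "c = 0" using assms(3) lam_pos
    by (simp add: h' conjT_M2[OF det] moebius.simps split: if_splits)
  then have "conjT h w = Tz w" by (intro conjT_stabiliser h) (simp add: h')
  then show ?thesis unfolding B conjT_mult by (simp add: conjT_def)
qed

section \<open>The quotient \<open>G5\<close>, its principal congruence subgroups and preimages in
  \<open>H5\<close>\<close>

lemma H5_mult [simp]: "A \<otimes>\<^bsub>H5\<^esub> B = A ** B" and H5_one [simp]: "\<one>\<^bsub>H5\<^esub> = mat 1"
  by (simp_all add: H5_def)

lemma group_H5: "group H5"
proof -
  have "subgroup (generate SL2Zlam {matS, matT}) SL2Zlam"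
    by (rule group.generate_is_subgroup[OF group_SL2Zlam]) (simp add: ST_in_SL2Zlam)
  from subgroup.subgroup_is_group[OF this group_SL2Zlam] show ?thesis by (simp add: H5_def)
qed

lemma inv_H5: "A \<in> H5c \<Longrightarrow> inv\<^bsub>H5\<^esub> A = adj A"
  by (rule group.inv_equality[OF group_H5]) (simp_all add: H5c_adj)

definition pm_coset :: "real^2^2 \<Rightarrow> (real^2^2) set" where
  "pm_coset A = {A, - A}"

lemma coset_ZI: "ZI #>\<^bsub>H5\<^esub> A = pm_coset A"
  by (auto simp: r_coset_def ZI_def pm_coset_def uminus_mult)

lemma normal_ZI: "ZI \<lhd> H5"
  unfolding group.normal_inv_iff[OF group_H5]
proof
  show "subgroup ZI H5"
    by (rule group.subgroupI[OF group_H5])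
      (auto simp: ZI_def uminus_mult inv_H5 H5c_uminus, simp_all add: mat_1_M2)
  show "\<forall>x\<in>H5c. \<forall>h\<in>ZI. x \<otimes>\<^bsub>H5\<^esub> h \<otimes>\<^bsub>H5\<^esub> inv\<^bsub>H5\<^esub> x \<in> ZI"
    by (auto simp: ZI_def uminus_mult inv_H5)
qed

lemma carrier_G5: "carrier G5 = pm_coset ` H5c"
  by (simp add: G5_def carrier_FactGroup coset_ZI)

lemma G5_mult: "A \<in> H5c \<Longrightarrow> B \<in> H5c \<Longrightarrow> pm_coset A \<otimes>\<^bsub>G5\<^esub> pm_coset B = pm_coset (A ** B)"
  using normal.rcos_sum[OF normal_ZI, of A B] by (simp add: G5_def coset_ZI)

lemma G5_one: "\<one>\<^bsub>G5\<^esub> = pm_coset (mat 1)"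
  by (simp add: G5_def ZI_def pm_coset_def)

lemma group_G5: "group G5"
  unfolding G5_def by (rule normal.factorgroup_is_group[OF normal_ZI])

lemma G5_inv: "A \<in> H5c \<Longrightarrow> inv\<^bsub>G5\<^esub> (pm_coset A) = pm_coset (adj A)"
  by (rule group.inv_equality[OF group_G5]) (auto simp: G5_mult G5_one H5c_adj carrier_G5)

lemma G5_pow: "T5 [^]\<^bsub>G5\<^esub> (w::nat) = pm_coset (Tz (int w))"
proof (induction w)
  case 0
  show ?case by (simp add: G5_one Tz_0)
next
  case (Suc w)
  have "T5 [^]\<^bsub>G5\<^esub> Suc w = pm_coset (Tz (int w)) \<otimes>\<^bsub>G5\<^esub> pm_coset matT"
    by (simp add: Suc) (simp add: T5_def coset_ZI)
  also have "\<dots> = pm_coset (Tz (int w) ** Tz 1)" by (simp add: G5_mult Tz_1)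
  finally show ?case by (simp flip: Tz_add add: add.commute)
qed

lemma G5_conjT: "A \<in> H5c \<Longrightarrow> pm_coset A \<otimes>\<^bsub>G5\<^esub> (T5 [^]\<^bsub>G5\<^esub> (w::nat)) \<otimes>\<^bsub>G5\<^esub> inv\<^bsub>G5\<^esub> (pm_coset A) = pm_coset (conjT A (int w))"
  by (simp add: G5_pow G5_inv G5_mult H5c_mult H5c_adj conjT_def)

lemma G5_act_pm_coset: "G5_act (pm_coset A) x = moebius A x"
  by (simp add: G5_act_def pm_coset_def moebius_uminus)

lemma cusps_eq: "cusps = (\<lambda>A. moebius A None) ` H5c"
proof -
  have "cusps = (\<lambda>g. G5_act g None) ` carrier G5" by (auto simp: cusps_def)
  then show ?thesis by (simp add: carrier_G5 image_image G5_act_pm_coset)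
qed

lemma G_pr_eq: "G_pr r = pm_coset ` H_pr r"
proof -
  have "H_pr r <#>\<^bsub>H5\<^esub> ZI = H_pr r \<union> uminus ` H_pr r"
    by (auto simp: set_mult_def ZI_def uminus_mult)
  moreover have "pm_coset (- A) = pm_coset A" for A by (auto simp: pm_coset_def)
  ultimately show ?thesis by (simp add: G_pr_def coset_ZI image_Un image_image)
qed

lemma H_pr_antimono: "s \<in> PIdl\<^bsub>Zlam\<^esub> r \<Longrightarrow> H_pr s \<subseteq> H_pr r"
  using PIdl_subset[of s r] unfolding H_pr_def by blast

definition lift :: "(real^2^2) set set \<Rightarrow> (real^2^2) set" where
  "lift K = {A \<in> H5c. pm_coset A \<in> K}"

lemma G_pr_subset_iff: "G_pr r \<subseteq> K \<longleftrightarrow> H_pr r \<subseteq> lift K"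
  by (auto simp: G_pr_eq lift_def H_pr_def)

lemma cusp_width_eq:
  "cusp_width K x = (LEAST w. 0 < w \<and> (\<exists>A\<in>H5c. conjT A (int w) \<in> lift K \<and> moebius (conjT A (int w)) x = x))"
  unfolding cusp_width_def
  by (rule arg_cong[where f = Least])
    (auto simp: fun_eq_iff carrier_G5 G5_conjT G5_act_pm_coset lift_def conjT_in_H5c)

lemma conjT_in_H_int: "g \<in> H5c \<Longrightarrow> conjT g M \<in> H_int M"
  using Delta_mcong[OF Delta_conjT[of g M M]] by (simp add: H_int_def conjT_in_H5c)

section \<open>Widths and geometric level of a congruence subgroup\<close>

context
  fixes K assumes K: "congruence_subgroup K"
begin

lemma lift_mult: "A \<in> lift K \<Longrightarrow> B \<in> lift K \<Longrightarrow> A ** B \<in> lift K"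
  using subgroup.m_closed[of K G5 "pm_coset A" "pm_coset B"] K
  by (simp add: congruence_subgroup_def lift_def G5_mult H5c_mult)

lemma lift_adj: "A \<in> lift K \<Longrightarrow> adj A \<in> lift K"
  using subgroup.m_inv_closed[of K G5 "pm_coset A"] K
  by (simp add: congruence_subgroup_def lift_def G5_inv H5c_adj)

lemma lift_1: "mat 1 \<in> lift K"
  using subgroup.one_closed[of K G5] K by (simp add: congruence_subgroup_def lift_def G5_one)

lemma lift_conjT_mult:
  assumes "g \<in> H5c" "conjT g w \<in> lift K" shows "conjT g (w * k) \<in> lift K"
proof -
  have n: "conjT g (w * int n) \<in> lift K" for n
    using assms by (induction n) (auto simp: conjT_0 lift_1 conjT_add lift_mult algebra_simps)
  show ?thesis
  proof (cases "k \<ge> 0")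
    case True
    then show ?thesis using n[of "nat k"] by simp
  next
    case False
    then show ?thesis using lift_adj[OF n[of "nat (- k)"]] by (simp add: adj_conjT)
  qed
qed

lemma lift_H_int: "\<exists>N>0. H_int (int N) \<subseteq> lift K"
proof -
  obtain r where r: "r \<in> Zl" "r \<noteq> 0" "G_pr r \<subseteq> K" using K by (auto simp: congruence_subgroup_def)
  obtain N where "N > 0" "real N \<in> PIdl\<^bsub>Zlam\<^esub> r" using PIdl_imp_pos_nat r by blast
  then show ?thesis
    using H_pr_antimono[of "real N" r] r(3) H_pr_eq_H_int[of "int N"] by (auto simp: G_pr_subset_iff)
qed

text \<open>The exponents \<open>k\<close> with \<open>conjT A k\<close> in the preimage form a
  subgroup of the integers, and the width is its positive generator.\<close>

lemma cusp_width:
  assumes A: "A \<in> H5c"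
  defines "w \<equiv> cusp_width K (moebius A None)"
  shows "0 < w" "conjT A (int w) \<in> lift K"
    "\<And>M. conjT A (int M) \<in> lift K \<Longrightarrow> w dvd M"
proof -
  define Q where "Q = (\<lambda>w. 0 < w \<and> (\<exists>B\<in>H5c. conjT B (int w) \<in> lift K \<and>
    moebius (conjT B (int w)) (moebius A None) = moebius A None))"
  have w: "w = (LEAST w. Q w)" unfolding w_def cusp_width_eq Q_def ..
  obtain N where "N > 0" "H_int (int N) \<subseteq> lift K" using lift_H_int by blast
  then have "Q N" using A conjT_in_H_int[OF A] moebius_conjT[OF A] by (auto simp: Q_def)
  then have Qw: "Q w" unfolding w by (rule LeastI)
  then show "0 < w" by (simp add: Q_def)
  from Qw show wA: "conjT A (int w) \<in> lift K" using conjT_fixes_cusp[OF A] by (auto simp: Q_def)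
  fix M assume M: "conjT A (int M) \<in> lift K"
  \<comment> \<open>A nonzero remainder would be a smaller candidate for the width.\<close>
  have "int (M mod w) = int M + int w * (- int (M div w))"
    by (metis minus_mult_div_eq_mod diff_conv_add_uminus mult_minus_right of_nat_mult zdiv_int zmod_int)
  then have "conjT A (int (M mod w)) = conjT A (int M) ** conjT A (int w * (- int (M div w)))"
    using A by (simp only: conjT_add)
  then have "conjT A (int (M mod w)) \<in> lift K"
    using lift_mult[OF M lift_conjT_mult[OF A wA]] by metis
  then have "M mod w > 0 \<longrightarrow> Q (M mod w)" using A moebius_conjT[OF A] by (auto simp: Q_def)
  moreover have "M mod w < w" using \<open>0 < w\<close> by simp
  ultimately have "M mod w = 0" using not_less_Least[of "M mod w" Q] w by auto
  then show "w dvd M" by auto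
qed

lemma geometric_level_dvd:
  assumes "H_int (int M) \<subseteq> lift K" shows "geometric_level K dvd M"
  unfolding geometric_level_def
proof (rule Lcm_least)
  fix w assume "w \<in> cusp_width K ` cusps"
  then obtain A where "A \<in> H5c" "w = cusp_width K (moebius A None)" by (auto simp: cusps_eq)
  then show "w dvd M" using assms conjT_in_H_int cusp_width(3) by blast
qed

text \<open>Some positive \<open>N\<close> is a multiple of all widths, which rules out the value 0
  of \<open>Lcm\<close>.\<close>

lemma geometric_level_pos: "geometric_level K > 0"
  using lift_H_int geometric_level_dvd by (metis dvd_0_left gr0I)

text \<open>The level, and with it the exponent \<open>k\<close> of each factor
  \<open>conjT g k\<close>, is divisible by the width of the cusp
  \<open>moebius g None\<close>.\<close>

lemma Delta_geometric_level: "Delta (int (geometric_level K)) \<subseteq> lift K"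
proof
  fix A assume "A \<in> Delta (int (geometric_level K))"
  then show "A \<in> lift K"
  proof (induction rule: Delta.induct)
    case (step A g k)
    define w where "w = cusp_width K (moebius g None)"
    have "w dvd geometric_level K"
      unfolding geometric_level_def w_def by (rule dvd_Lcm) (use step in \<open>auto simp: cusps_eq\<close>)
    then have "int w dvd k" using step by (meson dvd_trans of_nat_dvd_iff)
    then obtain l where "k = int w * l" by blast
    then have "conjT g k \<in> lift K" using lift_conjT_mult cusp_width(2) step by (simp add: w_def)
    then show ?case using lift_mult step by blast
  qed (rule lift_1)
qed

end

section \<open>The rational integer below the algebraic level\<close>

lemma integer_below_dvd:
  fixes M :: nat
  assumes "r \<in> Zl" "r \<noteq> 0"
  shows "real (integer_below (PIdl\<^bsub>Zlam\<^esub> r)) \<in> PIdl\<^bsub>Zlam\<^esub> r"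
    and "real M \<in> PIdl\<^bsub>Zlam\<^esub> r \<Longrightarrow> integer_below (PIdl\<^bsub>Zlam\<^esub> r) dvd M"
proof -
  define n where "n = integer_below (PIdl\<^bsub>Zlam\<^esub> r)"
  have n: "0 < n \<and> real n \<in> PIdl\<^bsub>Zlam\<^esub> r"
    unfolding n_def integer_below_def by (rule LeastI_ex[OF PIdl_imp_pos_nat[OF assms]])
  then show "real (integer_below (PIdl\<^bsub>Zlam\<^esub> r)) \<in> PIdl\<^bsub>Zlam\<^esub> r" by (simp add: n_def)
  assume "real M \<in> PIdl\<^bsub>Zlam\<^esub> r"
  \<comment> \<open>The remainder of \<open>M\<close> modulo \<open>n\<close> is in the ideal, so
    minimality of \<open>n\<close> makes it 0.\<close>
  then have "real M - real (M div n) * real n \<in> PIdl\<^bsub>Zlam\<^esub> r"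
    using n by (intro PIdl_diff PIdl_mult_left) simp_all
  also have "real M - real (M div n) * real n = real (M mod n)"
    by (metis add_diff_cancel_left' div_mult_mod_eq of_nat_add of_nat_mult)
  finally have "\<not> 0 < M mod n"
    using not_less_Least[of "M mod n" "\<lambda>n. 0 < n \<and> real n \<in> PIdl\<^bsub>Zlam\<^esub> r"] n
    by (auto simp: n_def integer_below_def)
  then show "integer_below (PIdl\<^bsub>Zlam\<^esub> r) dvd M" by (auto simp: n_def)
qed

text \<open>\<open>T ^ M\<close> is the test element: its upper right entry is \<open>M\<close>
  times the unit \<open>lam\<close>, and passing to the negative matrix only changes the sign of
  that entry.\<close>

lemma G_pr_subset_imp_mem:
  assumes "G_pr (real M) \<subseteq> G_pr r" shows "real M \<in> PIdl\<^bsub>Zlam\<^esub> r"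
proof -
  have "Tz (int M) \<in> H_int (int M)" using conjT_in_H_int[of "mat 1" "int M"] by (simp add: conjT_1)
  then have "pm_coset (Tz (int M)) \<in> G_pr r"
    using assms H_pr_eq_H_int[of "int M"] by (auto simp: G_pr_eq)
  then obtain A where A: "A \<in> H_pr r" "pm_coset (Tz (int M)) = pm_coset A" by (auto simp: G_pr_eq)
  then have "A = Tz (int M) \<or> A = - Tz (int M)" by (auto simp: pm_coset_def doubleton_eq_iff)
  moreover have "A $ 1 $ 2 - (mat 1 :: real^2^2) $ 1 $ 2 \<in> PIdl\<^bsub>Zlam\<^esub> r" using A(1) unfolding H_pr_def by blast
  ultimately have "real M * lam \<in> PIdl\<^bsub>Zlam\<^esub> r"
    using PIdl_minus[of "- (real M * lam)" r] by (auto simp: Tz_def mat_1_M2)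
  then show ?thesis by (rule PIdl_lam_mult)
qed

theorem theorem4p1:
  fixes K :: "(real^2^2) set set" and \<pi> :: real and m n :: nat
  assumes "congruence_subgroup K"
    and "m = geometric_level K"
    and "\<pi> \<in> carrier Zlam"
    and "is_algebraic_level K (PIdl\<^bsub>Zlam\<^esub> \<pi>)"
    and "n = integer_below (PIdl\<^bsub>Zlam\<^esub> \<pi>)"
  shows "(m mod 4 \<noteq> 0 \<longrightarrow> G_pr (real m) \<subseteq> K \<and> n = m) \<and>
         (4 dvd m \<longrightarrow> G_pr (real (2 * m)) \<subseteq> K \<and> (n = m \<or> n = 2 * m))"
proof -
  note K = assms(1)
  have H_int: "G_pr (real M) \<subseteq> K \<longleftrightarrow> H_int (int M) \<subseteq> lift K" for M
    using H_pr_eq_H_int[of "int M"] by (simp add: G_pr_subset_iff)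
  have "m > 0" "Delta (int m) \<subseteq> lift K"
    using geometric_level_pos[OF K] Delta_geometric_level[OF K] assms(2) by simp_all
  obtain N where N: "N > 0" "H_int (int N) \<subseteq> lift K" using lift_H_int[OF K] by blast
  \<comment> \<open>The definition of the level provides some generator \<open>r\<close> of the
    ideal, possibly other than \<open>\<pi>\<close>.\<close>
  obtain r where r: "r \<in> Zl" "r \<noteq> 0" "PIdl\<^bsub>Zlam\<^esub> \<pi> = PIdl\<^bsub>Zlam\<^esub> r" "G_pr r \<subseteq> K"
    and min: "\<And>\<tau>. \<tau> \<in> Zl \<Longrightarrow> G_pr \<tau> \<subseteq> K \<Longrightarrow> G_pr \<tau> \<subseteq> G_pr r"
    using assms(4) unfolding is_algebraic_level_def by blast
  have n: "real n \<in> PIdl\<^bsub>Zlam\<^esub> r" "\<And>M. real M \<in> PIdl\<^bsub>Zlam\<^esub> r \<Longrightarrow> n dvd M"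
    using integer_below_dvd[OF r(1,2)] unfolding assms(5) r(3) by blast+
  have n_dvd: "n dvd M" if "G_pr (real M) \<subseteq> K" for M
    using n(2) G_pr_subset_imp_mem[OF min] that by simp
  \<comment> \<open>As \<open>n\<close> lies in the level ideal, \<open>G_pr n\<close> is contained
    in \<open>K\<close>, so every width divides \<open>n\<close>.\<close>
  have "H_pr (real n) \<subseteq> lift K" using H_pr_antimono[OF n(1)] r(4) by (auto simp: G_pr_subset_iff)
  then have "m dvd n" using geometric_level_dvd[OF K, of n] H_pr_eq_H_int[of "int n"] assms(2) by simp
  show ?thesis
  proof (intro conjI impI)
    assume "m mod 4 \<noteq> 0"
    then have "\<not> 4 dvd m" by auto
    show "G_pr (real m) \<subseteq> K"
      unfolding H_int by (rule H_int_subset_not_4_dvd[where N = N])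
        (fact lift_mult[OF K] N \<open>Delta (int m) \<subseteq> lift K\<close> \<open>\<not> 4 dvd m\<close>)+
    \<comment> \<open>Minimality of the level puts \<open>m\<close> into the ideal, so
      \<open>n\<close> divides \<open>m\<close>.\<close>
    then show "n = m" using n_dvd \<open>m dvd n\<close> by (simp add: dvd_antisym)
  next
    assume "4 dvd m"
    show G: "G_pr (real (2 * m)) \<subseteq> K"
      unfolding H_int by (rule H_int_subset_4_dvd[where N = N])
        (fact lift_mult[OF K] N \<open>Delta (int m) \<subseteq> lift K\<close> \<open>4 dvd m\<close> \<open>m > 0\<close>)+
    then have "n dvd 2 * m" by (rule n_dvd)
    moreover obtain k where k: "n = m * k" using \<open>m dvd n\<close> by blast
    ultimately have "k dvd 2" using \<open>m > 0\<close> by (simp add: mult.commute)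
    then have "k \<le> 2" "k \<noteq> 0" using dvd_imp_le[of k 2] by (simp, intro notI, simp)
    then have "k = 1 \<or> k = 2" by linarith
    then show "n = m \<or> n = 2 * m" using k by auto
  qed
qed

end
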